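(* Consider the stochastic evolution equation $$dU=(p\,\mathrm{Id}+\mathcal{A})U\,dt+\sigma B\,dW$$ on $H$ and assume $\mathrm{spec}(\mathcal{A})=\{\lambda_*\}\cup\mathrm{spec}_-(\mathcal{A})$, with $\mathrm{Re}(\lambda_* )=0$ and $\mathrm{spec}_-(\mathcal{A})\subset\{z\in\mathbb{C}:\mathrm{Re}(z)<0\}$. Also assume that $BQB^*\geq c>0$ for some constant $c$ (in particular this holds for $B=Q=\mathrm{Id}$). Then there exists a sequence $\{u_k\}_{k\in\mathbb{N}}\subset H$ such that for each $k$ $$\lim_{p\to 0^-}\langle V_\infty u_k,u_k\rangle=+\infty .$$
   Context: $H$ is a Hilbert space with inner product $\langle\cdot,\cdot\rangle$; $\mathcal{A}:\mathcal{D}(\mathcal{A})\subset H\to H$ is a closed linear operator with spectrum $\mathrm{spec}(\mathcal{A})$; $p\in\mathbb{R}$ is a parameter, and $A=A(p)=p\,\mathrm{Id}+\mathcal{A}$ generates a strongly continuous semigroup $e^{tA}$. $W$ is a (generalized) Wiener process on $H$ with covariance operator $Q$, a non-negative self-adjoint operator on $H$ (e.g. $Q=\mathrm{Id}$, cylindrical noise); $B$ is a linear operator on $H$; $\sigma>0$ is a constant; the initial condition is $U(0)=0$. A star denotes the adjoint. $BQB^*\geq c$ means $\langle BQB^*h,h\rangle\geq c\Vert h\Vert^2$ for all $h\in H$. The covariance operator of the stochastic convolution $\sigma\int_0^t e^{(t-s)A}B\,dW_s$ is $$V(t)=\sigma^2\int_0^t e^{\tau A}BQB^*e^{\tau A^*}\,d\tau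 ,$$ and $V_\infty:=\lim_{t\to\infty}V(t)$. For $p<0$ the steady state $0$ of $\partial_t U=A(p)U$ is stable, and $V_\infty$ satisfies the Lyapunov equation $\langle AV_\infty g,h\rangle+\langle V_\infty A^*g,h\rangle=-\sigma^2\langle BQB^*g,h\rangle$ for all $g,h$ for which the expression is well defined. *)

theory Defs
  imports "HOL-Analysis.Analysis"
begin

section \<open>Complex Hilbert spaces\<close>

text \<open>
  The distribution only has real inner product spaces. As the spectrum of an operator is a set of
  complex numbers, the Hilbert space is a complex one. The inner product is linear in its first
  argument. Positive definiteness is contained in the axiom relating it to the norm.
\<close>

class complex_hilbert = banach +
  fixes scaleC :: "complex \<Rightarrow> 'a \<Rightarrow> 'a"  (infixr \<open>*\<^sub>C\<close> 75)
    and cinner :: "'a \<Rightarrow> 'a \<Rightarrow> complex"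
  assumes scaleC_add_right: "a *\<^sub>C (x + y) = a *\<^sub>C x + a *\<^sub>C y"
    and scaleC_add_left: "(a + b) *\<^sub>C x = a *\<^sub>C x + b *\<^sub>C x"
    and scaleC_scaleC: "a *\<^sub>C b *\<^sub>C x = (a * b) *\<^sub>C x"
    and scaleC_of_real: "complex_of_real r *\<^sub>C x = r *\<^sub>R x"
    and cinner_commute: "cinner x y = cnj (cinner y x)"
    and cinner_add_left: "cinner (x + y) z = cinner x z + cinner y z"
    and cinner_scaleC_left: "cinner (a *\<^sub>C x) y = a * cinner x y"
    and cinner_self: "cinner x x = complex_of_real ((norm x)\<^sup>2)"

instantiation complex :: complex_hilbert
begin
definition scaleC_complex :: "complex \<Rightarrow> complex \<Rightarrow> complex" where "scaleC_complex a x = a * x"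
definition cinner_complex :: "complex \<Rightarrow> complex \<Rightarrow> complex" where "cinner_complex x y = x * cnj y"
instance
proof
  fix x :: complex
  show "cinner x x = complex_of_real ((norm x)\<^sup>2)"
    unfolding cinner_complex_def by (rule complex_norm_square [symmetric])
qed (simp_all add: scaleC_complex_def cinner_complex_def algebra_simps scaleR_conv_of_real)
end

section \<open>Possibly unbounded operators\<close>

text \<open>
  An operator is identified with its graph \<open>G\<close>: its domain is \<open>Domain G\<close>, and the composition
  ``first \<open>F\<close>, then \<open>G\<close>'', on its natural domain, is the relational composition \<open>F O G\<close>.
\<close>

type_synonym 'a operator = "('a \<times> 'a) set"

definition linear_operator :: "'a::complex_hilbert operator \<Rightarrow> bool" where
  "linear_operator G \<longleftrightarrow>
     single_valued G \<and> (0, 0) \<in> G \<and>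
     (\<forall>x y x' y'. (x, y) \<in> G \<longrightarrow> (x', y') \<in> G \<longrightarrow> (x + x', y + y') \<in> G) \<and>
     (\<forall>a x y. (x, y) \<in> G \<longrightarrow> (a *\<^sub>C x, a *\<^sub>C y) \<in> G)"

definition closed_operator :: "'a::complex_hilbert operator \<Rightarrow> bool" where
  "closed_operator G \<longleftrightarrow> linear_operator G \<and> closed G"

definition densely_defined :: "'a::complex_hilbert operator \<Rightarrow> bool" where
  "densely_defined G \<longleftrightarrow> closure (Domain G) = UNIV"

definition op_apply :: "'a::complex_hilbert operator \<Rightarrow> 'a \<Rightarrow> 'a" where
  "op_apply G x = (THE y. (x, y) \<in> G)"

text \<open>The operator \<open>z Id + G\<close>, with the domain of \<open>G\<close>.\<close>

definition scalar_plus :: "complex \<Rightarrow> 'a::complex_hilbert operator \<Rightarrow> 'a operator" where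
  "scalar_plus z G = {(x, z *\<^sub>C x + y) | x y. (x, y) \<in> G}"

text \<open>This is (the graph of) an operator when \<open>G\<close> is densely defined.\<close>

definition op_adjoint :: "'a::complex_hilbert operator \<Rightarrow> 'a operator" where
  "op_adjoint G = {(y, z). \<forall>(x, w) \<in> G. cinner w y = cinner x z}"

definition self_adjoint :: "'a::complex_hilbert operator \<Rightarrow> bool" where
  "self_adjoint G \<longleftrightarrow> linear_operator G \<and> densely_defined G \<and> op_adjoint G = G"

definition nonnegative :: "'a::complex_hilbert operator \<Rightarrow> bool" where
  "nonnegative G \<longleftrightarrow> (\<forall>(x, y) \<in> G. Re (cinner y x) \<ge> 0)"

text \<open>
  \<open>\<langle>G h, h\<rangle> \<ge> c \<parallel>h\<parallel>\<^sup>2\<close> for all \<open>h\<close> in the whole space; in particular \<open>G\<close> is everywhere defined.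
\<close>

definition bounded_below_by :: "'a::complex_hilbert operator \<Rightarrow> real \<Rightarrow> bool" where
  "bounded_below_by G c \<longleftrightarrow> (\<forall>h. \<exists>y. (h, y) \<in> G \<and> Re (cinner y h) \<ge> c * (norm h)\<^sup>2)"

definition bounded_clinear :: "('a::complex_hilbert \<Rightarrow> 'a) \<Rightarrow> bool" where
  "bounded_clinear f \<longleftrightarrow> bounded_linear f \<and> (\<forall>a x. f (a *\<^sub>C x) = a *\<^sub>C f x)"

text \<open>
  \<open>z\<close> is in the resolvent set iff \<open>G - z Id\<close> is a bijection from its domain onto the whole space
  whose inverse \<open>R\<close> is bounded.
\<close>

definition resolvent_set :: "'a::complex_hilbert operator \<Rightarrow> complex set" where
  "resolvent_set G = {z. \<exists>R. bounded_clinear R \<and> scalar_plus (- z) G = {(R y, y) | y. True}}"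

definition spec :: "'a::complex_hilbert operator \<Rightarrow> complex set" where
  "spec G = - resolvent_set G"

section \<open>Strongly continuous semigroups\<close>

text \<open>Only times \<open>t \<ge> 0\<close> matter.\<close>

definition C0_semigroup :: "(real \<Rightarrow> 'a::complex_hilbert \<Rightarrow> 'a) \<Rightarrow> bool" where
  "C0_semigroup T \<longleftrightarrow>
     (\<forall>t\<ge>0. bounded_clinear (T t)) \<and>
     (\<forall>x. T 0 x = x) \<and>
     (\<forall>s\<ge>0. \<forall>t\<ge>0. \<forall>x. T (s + t) x = T s (T t x)) \<and>
     (\<forall>x. ((\<lambda>t. T t x) \<longlongrightarrow> x) (at_right 0))"

definition generator :: "(real \<Rightarrow> 'a::complex_hilbert \<Rightarrow> 'a) \<Rightarrow> 'a operator" where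
  "generator T = {(x, y). ((\<lambda>t. (1 / t) *\<^sub>R (T t x - x)) \<longlongrightarrow> y) (at_right 0)}"

definition generates :: "'a::complex_hilbert operator \<Rightarrow> (real \<Rightarrow> 'a \<Rightarrow> 'a) \<Rightarrow> bool" where
  "generates A T \<longleftrightarrow> C0_semigroup T \<and> generator T = A"

text \<open>
  \<open>sg_exp A t\<close> is \<open>e\<^bsup>tA\<^esup>\<close>, the semigroup generated by \<open>A\<close>. A generator determines its semigroup
  for \<open>t \<ge> 0\<close>, so there the choice is unique.
\<close>

definition sg_exp :: "'a::complex_hilbert operator \<Rightarrow> real \<Rightarrow> 'a \<Rightarrow> 'a" where
  "sg_exp A = (SOME T. generates A T)"

text \<open>Lyapunov stability of the steady state \<open>0\<close> of \<open>\<partial>\<^sub>t U = A U\<close>.\<close>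

definition zero_stable :: "'a::complex_hilbert operator \<Rightarrow> bool" where
  "zero_stable A \<longleftrightarrow>
     (\<forall>\<epsilon>>0. \<exists>\<delta>>0. \<forall>u\<^sub>0. norm u\<^sub>0 < \<delta> \<longrightarrow> (\<forall>t\<ge>0. norm (sg_exp A t u\<^sub>0) < \<epsilon>))"

section \<open>Covariance of the stochastic convolution\<close>

definition noise_cov :: "'a::complex_hilbert operator \<Rightarrow> 'a operator \<Rightarrow> 'a operator" where
  "noise_cov B Q = op_adjoint B O Q O B"

lemma noise_cov_Id_bounded_below: "bounded_below_by (noise_cov Id Id) 1"
proof -
  have "(h, h) \<in> noise_cov Id Id" for h :: 'a
    by (auto simp: noise_cov_def op_adjoint_def)
  then show ?thesis
    unfolding bounded_below_by_def by (force simp: cinner_self)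
qed

text \<open>
  The covariance operators at time \<open>t\<close> and in the limit \<open>t \<rightarrow> \<infinity>\<close> of the solution, started at \<open>0\<close>,
  of \<open>dU = A U dt + \<sigma> B dW\<close>, where the Wiener process \<open>W\<close> has covariance operator \<open>Q\<close>. Integral
  and limit are taken in the strong sense, i.e. after application to a fixed vector \<open>h\<close>.
\<close>

definition cov :: "real \<Rightarrow> 'a::complex_hilbert operator \<Rightarrow> 'a operator \<Rightarrow> 'a operator
    \<Rightarrow> real \<Rightarrow> 'a \<Rightarrow> 'a" where
  "cov \<sigma> A B Q t h =
     \<sigma>\<^sup>2 *\<^sub>R integral {0..t}
       (\<lambda>\<tau>. sg_exp A \<tau> (op_apply (noise_cov B Q) (sg_exp (op_adjoint A) \<tau> h)))"

definition cov_inf :: "real \<Rightarrow> 'a::complex_hilbert operator \<Rightarrow> 'a operator \<Rightarrow> 'a operator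
    \<Rightarrow> 'a \<Rightarrow> 'a" where
  "cov_inf \<sigma> A B Q h = Lim at_top (\<lambda>t. cov \<sigma> A B Q t h)"

end

theory Submission
  imports Defs
begin

text \<open>
  Write \<open>T\<close> for the semigroup generated by \<open>\<A>\<close> and \<open>N\<close> for the covariance \<open>BQB\<^sup>*\<close> of the noise. The
  operator \<open>p Id + \<A>\<close> generates \<open>e\<^sup>p\<^sup>t T t\<close>, and its adjoint generates \<open>e\<^sup>p\<^sup>t T\<^sup>* t\<close>
  (\<open>generates_rescale\<close>, \<open>generates_adj\<close>). As a semigroup is determined by its generator
  (\<open>semigroup_unique\<close>), for \<open>p < 0\<close>
    \<open>\<langle>V\<^sub>\<infinity> u, u\<rangle> = \<sigma>\<^sup>2 \<integral>\<^sub>0\<^sup>\<infinity> e\<^sup>2\<^sup>p\<^sup>s \<langle>N (T\<^sup>* s u), T\<^sup>* s u\<rangle> ds \<ge> \<sigma>\<^sup>2 c \<integral>\<^sub>0\<^sup>\<infinity> e\<^sup>2\<^sup>p\<^sup>s \<parallel>T\<^sup>* s u\<parallel>\<^sup>2 ds\<close>.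
  The integral for \<open>V\<^sub>\<infinity>\<close> converges because stability for every negative \<open>p\<close> makes \<open>e\<^sup>p\<^sup>t T t\<close> decay
  exponentially, and because \<open>N\<close>, being symmetric and everywhere defined, is bounded
  (\<open>cov_inf_lower_bound\<close>, \<open>symmetric_bounded_linear\<close>). If \<open>\<integral>\<^sub>0\<^sup>\<infinity> \<parallel>T\<^sup>* s u\<parallel>\<^sup>2 ds = \<infinity>\<close>, the
  right-hand side tends to infinity as \<open>p\<close> increases to \<open>0\<close>. So a single vector \<open>u\<close> whose orbit under
  \<open>T\<^sup>*\<close> is not square integrable yields the theorem, with a constant sequence.

  Such a vector exists by an argument in the spirit of the Datko-Pazy theorem
  (\<open>orbit_not_square_integrable\<close>). If all these orbits were square integrable, then for \<open>\<epsilon> > 0\<close> the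
  Laplace representation of the resolvent \<open>R\<^sub>\<epsilon>\<close> of \<open>\<A>\<close> at \<open>\<lambda>\<^sub>* + \<epsilon>\<close> and the Cauchy-Schwarz inequality
  would bound every \<open>\<surd>\<epsilon> \<bar>\<langle>R\<^sub>\<epsilon> y, u\<rangle>\<bar>\<close> with \<open>\<parallel>y\<parallel> \<le> 1\<close> by a constant depending on \<open>u\<close> only
  (\<open>resolvent_weak_bound\<close>). By uniform boundedness \<open>\<parallel>R\<^sub>\<epsilon>\<parallel> \<le> C / \<surd>\<epsilon>\<close>, so \<open>\<epsilon> \<parallel>R\<^sub>\<epsilon>\<parallel> < 1\<close> for small \<open>\<epsilon>\<close>,
  and a perturbation of the resolvent shows that \<open>\<lambda>\<^sub>*\<close> is not in the spectrum
  (\<open>resolvent_set_perturb\<close>).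

  The adjoints of \<open>T t\<close> come from the Riesz representation theorem. Their strong continuity at \<open>0\<close> is a
  Hilbert space phenomenon: it rests on the density of the domain of \<open>\<A>\<^sup>*\<close>
  (\<open>adj_semigroup_tendsto_0\<close>).
\<close>

section \<open>Geometry of complex Hilbert spaces\<close>

lemma cinner_add_right: "cinner x (y + z) = cinner x y + cinner x z"
  for x y z :: "'a::complex_hilbert"
  by (metis cinner_add_left cinner_commute complex_cnj_add)

lemma cinner_scaleC_right: "cinner x (a *\<^sub>C y) = cnj a * cinner x y"
  for x y :: "'a::complex_hilbert"
  by (metis cinner_commute cinner_scaleC_left complex_cnj_mult)

lemma cinner_scaleR_left: "cinner (r *\<^sub>R x) y = complex_of_real r * cinner x y"
  for x y :: "'a::complex_hilbert"
  by (metis cinner_scaleC_left scaleC_of_real)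

lemma cinner_scaleR_right: "cinner x (r *\<^sub>R y) = complex_of_real r * cinner x y"
  for x y :: "'a::complex_hilbert"
  by (metis cinner_scaleC_right complex_cnj_complex_of_real scaleC_of_real)

lemma cinner_minus_left: "cinner (- x) y = - cinner x y"
  for x y :: "'a::complex_hilbert"
  using cinner_scaleR_left[of "-1" x y] by simp

lemma cinner_minus_right: "cinner x (- y) = - cinner x y"
  for x y :: "'a::complex_hilbert"
  using cinner_scaleR_right[of x "-1" y] by simp

lemma cinner_diff_left: "cinner (x - y) z = cinner x z - cinner y z"
  for x y z :: "'a::complex_hilbert"
  using cinner_add_left[of x "- y" z] by (simp add: cinner_minus_left)

lemma cinner_diff_right: "cinner x (y - z) = cinner x y - cinner x z"
  for x y z :: "'a::complex_hilbert"
  using cinner_add_right[of x y "- z"] by (simp add: cinner_minus_right)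

lemma cinner_zero_left [simp]: "cinner 0 y = 0"
  for y :: "'a::complex_hilbert"
  using cinner_diff_left[of y y y] by simp

lemma cinner_zero_right [simp]: "cinner y 0 = 0"
  for y :: "'a::complex_hilbert"
  using cinner_diff_right[of y y y] by simp

lemma cinner_self_eq_0: "cinner x x = 0 \<longleftrightarrow> x = 0"
  for x :: "'a::complex_hilbert"
  by (simp add: cinner_self)

lemma cinner_eqI: "(\<And>x. cinner x y = cinner x z) \<Longrightarrow> y = z"
  for y z :: "'a::complex_hilbert"
  by (metis cinner_diff_right cinner_self_eq_0 right_minus_eq)

lemma norm_add_squared: "(norm (x + y))\<^sup>2 = (norm x)\<^sup>2 + 2 * Re (cinner x y) + (norm y)\<^sup>2"
  for x y :: "'a::complex_hilbert"
proof -
  have "Re (cinner y x) = Re (cinner x y)"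
    using arg_cong[OF cinner_commute[of y x], of Re] by simp
  moreover have "complex_of_real ((norm (x + y))\<^sup>2)
      = complex_of_real ((norm x)\<^sup>2) + (cinner x y + cinner y x) + complex_of_real ((norm y)\<^sup>2)"
    by (simp only: cinner_self [symmetric]) (simp add: cinner_add_left cinner_add_right)
  then have "Re (complex_of_real ((norm (x + y))\<^sup>2))
      = Re (complex_of_real ((norm x)\<^sup>2) + (cinner x y + cinner y x) + complex_of_real ((norm y)\<^sup>2))"
    by simp
  ultimately show ?thesis by simp
qed

lemma norm_diff_squared: "(norm (x - y))\<^sup>2 = (norm x)\<^sup>2 - 2 * Re (cinner x y) + (norm y)\<^sup>2"
  for x y :: "'a::complex_hilbert"
  using norm_add_squared[of x "- y"] by (simp add: cinner_minus_right)

lemma norm_scaleC: "norm (a *\<^sub>C x) = cmod a * norm x"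
  for x :: "'a::complex_hilbert"
proof -
  have "cinner (a *\<^sub>C x) (a *\<^sub>C x) = (a * cnj a) * cinner x x"
    by (simp add: cinner_scaleC_left cinner_scaleC_right)
  then have "complex_of_real ((norm (a *\<^sub>C x))\<^sup>2) = complex_of_real ((cmod a * norm x)\<^sup>2)"
    unfolding cinner_self complex_norm_square [symmetric] by (simp add: power_mult_distrib)
  then have "(norm (a *\<^sub>C x))\<^sup>2 = (cmod a * norm x)\<^sup>2"
    by (simp only: of_real_eq_iff)
  then show ?thesis by simp
qed

lemma scaleC_one [simp]: "1 *\<^sub>C x = x"
  for x :: "'a::complex_hilbert"
  using scaleC_of_real[of 1 x] by simp

lemma scaleC_zero_left [simp]: "0 *\<^sub>C x = 0"
  for x :: "'a::complex_hilbert"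
  using scaleC_of_real[of 0 x] by simp

lemma scaleC_zero_right [simp]: "a *\<^sub>C 0 = (0::'a::complex_hilbert)"
  using norm_scaleC[of a "0::'a"] by simp

lemma scaleC_minus_left: "(- a) *\<^sub>C x = - (a *\<^sub>C x)"
  for x :: "'a::complex_hilbert"
  using scaleC_add_left[of a "- a" x] by (simp add: add_eq_0_iff)

lemma scaleC_minus_right: "a *\<^sub>C (- x) = - (a *\<^sub>C x)"
  for x :: "'a::complex_hilbert"
  using scaleC_add_right[of a x "- x"] by (simp add: add_eq_0_iff)

lemma scaleC_diff_right: "a *\<^sub>C (x - y) = a *\<^sub>C x - a *\<^sub>C y"
  for x y :: "'a::complex_hilbert"
  using scaleC_add_right[of a x "- y"] by (simp add: scaleC_minus_right)

lemma scaleC_scaleR: "a *\<^sub>C (r *\<^sub>R x) = r *\<^sub>R (a *\<^sub>C x)"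
  for x :: "'a::complex_hilbert"
  by (metis mult.commute scaleC_of_real scaleC_scaleC)

lemma norm_cinner_le: "cmod (cinner x y) \<le> norm x * norm y"
  for x y :: "'a::complex_hilbert"
proof (cases "cinner x y = 0")
  case False
  define a where "a = cnj (sgn (cinner x y))"
  have a: "a * cinner x y = complex_of_real (cmod (cinner x y))" "cmod a = 1"
  proof -
    show "cmod a = 1" using False by (simp add: a_def norm_sgn)
    show "a * cinner x y = complex_of_real (cmod (cinner x y))"
      using False complex_norm_square[of "cinner x y"]
      by (simp add: a_def sgn_eq field_simps power2_eq_square)
  qed
  have re: "Re (cinner (a *\<^sub>C x) y) = cmod (cinner x y)"
    by (simp add: cinner_scaleC_left a(1))
  define s where "s = norm x"
  define t where "t = norm y"
  have st: "s \<noteq> 0" "t \<noteq> 0"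
    using False by (auto simp: s_def t_def)
  have "0 \<le> (norm (t *\<^sub>R (a *\<^sub>C x) - s *\<^sub>R y))\<^sup>2"
    by simp
  also have "\<dots> = 2 * (t * s)\<^sup>2 - 2 * (t * s) * cmod (cinner x y)"
    by (simp add: norm_diff_squared cinner_scaleR_left cinner_scaleR_right re a(2) norm_scaleC
        s_def t_def power_mult_distrib)
  finally have "(t * s) * cmod (cinner x y) \<le> (t * s) * (t * s)"
    by (simp add: power2_eq_square)
  moreover have "t * s > 0"
    using st by (simp add: s_def t_def)
  ultimately have "cmod (cinner x y) \<le> t * s"
    by (rule mult_left_le_imp_le)
  then show ?thesis
    by (simp add: s_def t_def mult.commute)
qed simp

lemma bounded_bilinear_cinner: "bounded_bilinear (cinner :: 'a::complex_hilbert \<Rightarrow> 'a \<Rightarrow> complex)"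
proof
  show "\<exists>K. \<forall>a b. cmod (cinner a b) \<le> norm (a::'a) * norm (b::'a) * K"
    by (rule exI[of _ 1]) (simp add: norm_cinner_le)
qed (simp_all add: cinner_add_left cinner_add_right cinner_scaleR_left cinner_scaleR_right
    scaleR_conv_of_real)

lemma bounded_bilinear_scaleC:
  "bounded_bilinear (scaleC :: complex \<Rightarrow> 'a::complex_hilbert \<Rightarrow> 'a)"
proof
  fix r and a :: complex and x :: 'a
  show "(r *\<^sub>R a) *\<^sub>C x = r *\<^sub>R (a *\<^sub>C x)"
    by (metis scaleC_of_real scaleC_scaleC scaleR_conv_of_real)
  show "\<exists>K. \<forall>a b. norm (a *\<^sub>C (b::'a)) \<le> norm a * norm b * K"
    by (rule exI[of _ 1]) (simp add: norm_scaleC)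
qed (simp_all add: scaleC_add_left scaleC_add_right scaleC_scaleR)

lemmas tendsto_cinner = bounded_bilinear.tendsto [OF bounded_bilinear_cinner]
lemmas tendsto_scaleC = bounded_bilinear.tendsto [OF bounded_bilinear_scaleC]
lemmas bounded_linear_cinner_left = bounded_bilinear.bounded_linear_left [OF bounded_bilinear_cinner]
lemmas bounded_linear_cinner_right = bounded_bilinear.bounded_linear_right [OF bounded_bilinear_cinner]

text \<open>
  The closest point \<open>m\<close> to \<open>x\<close> in \<open>M\<close> exists because minimising sequences are Cauchy, by the
  parallelogram law; the vector \<open>x - m\<close> is then orthogonal to \<open>M\<close>.
\<close>

lemma orthogonal_vector_exists:
  fixes M :: "'a::complex_hilbert set"
  assumes closed: "closed M" and zero: "0 \<in> M"
    and add: "\<And>x y. x \<in> M \<Longrightarrow> y \<in> M \<Longrightarrow> x + y \<in> M"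
    and scale: "\<And>a x. x \<in> M \<Longrightarrow> a *\<^sub>C x \<in> M"
    and x: "x \<notin> M"
  obtains z where "z \<noteq> 0" "\<And>m. m \<in> M \<Longrightarrow> cinner m z = 0"
proof -
  define d where "d = infdist x M"
  have d: "d \<le> norm (x - m)" if "m \<in> M" for m
    using infdist_le[OF that] by (simp add: d_def dist_norm)
  have d0: "d \<ge> 0"
    by (simp add: d_def infdist_nonneg)
  have ne: "M \<noteq> {}" using zero by auto
  have "\<exists>m\<in>M. norm (x - m) < d + 1 / Suc n" for n
  proof -
    have "(INF a\<in>M. dist x a) < d + 1 / Suc n"
      using ne by (simp add: d_def infdist_def del: of_nat_Suc)
    then obtain m where "m \<in> M" "dist x m < d + 1 / Suc n"
      by (subst (asm) cINF_less_iff) (auto simp: ne)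
    then show ?thesis by (auto simp: dist_norm)
  qed
  then obtain m where m: "\<And>n. m n \<in> M" "\<And>n. norm (x - m n) < d + 1 / Suc n"
    by metis
  have lim_eps: "(\<lambda>n. d + 1 / real (Suc n)) \<longlonglongrightarrow> d"
    using tendsto_add[OF tendsto_const LIMSEQ_Suc[OF lim_inverse_n']] by simp
  have lim: "(\<lambda>n. norm (x - m n)) \<longlonglongrightarrow> d"
    by (rule tendsto_sandwich[OF _ _ tendsto_const lim_eps])
      (use d m in \<open>auto intro!: always_eventually less_imp_le\<close>)
  \<comment> \<open>The midpoint of two elements of \<open>M\<close> lies in \<open>M\<close>, hence has distance at least \<open>d\<close> from \<open>x\<close>.\<close>
  have par: "(norm (m i - m j))\<^sup>2 \<le> 2 * ((norm (x - m i))\<^sup>2 - d\<^sup>2) + 2 * ((norm (x - m j))\<^sup>2 - d\<^sup>2)" for i j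
  proof -
    let ?a = "x - m i" and ?b = "x - m j"
    have "(1/2) *\<^sub>R (m i + m j) \<in> M"
      using scale[OF add[OF m(1) m(1)], of "complex_of_real (1/2)" i j] by (simp only: scaleC_of_real)
    from d[OF this] have "2 * d \<le> norm (2 *\<^sub>R (x - (1/2) *\<^sub>R (m i + m j)))"
      by simp
    also have "2 *\<^sub>R (x - (1/2) *\<^sub>R (m i + m j)) = ?a + ?b"
      by (simp add: algebra_simps scaleR_2)
    finally have "(2 * d)\<^sup>2 \<le> (norm (?a + ?b))\<^sup>2"
      using d0 by (intro power_mono) auto
    moreover have "(norm (a - b))\<^sup>2 + (norm (a + b))\<^sup>2 = 2 * (norm a)\<^sup>2 + 2 * (norm b)\<^sup>2"
      for a b :: 'a
      by (simp add: norm_add_squared norm_diff_squared)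
    note this[of ?a ?b]
    moreover have "?a - ?b = - (m i - m j)"
      by simp
    ultimately show ?thesis
      by (simp only: norm_minus_cancel) (simp add: power_mult_distrib)
  qed
  have "Cauchy m"
  proof (rule metric_CauchyI)
    fix e :: real assume e: "e > 0"
    have "(\<lambda>n. (norm (x - m n))\<^sup>2 - d\<^sup>2) \<longlonglongrightarrow> 0"
      using tendsto_diff[OF tendsto_power[OF lim, of 2] tendsto_const[of "d\<^sup>2"]] by simp
    then have "\<forall>\<^sub>F n in sequentially. (norm (x - m n))\<^sup>2 - d\<^sup>2 < e\<^sup>2 / 4"
      by (rule order_tendstoD(2)) (use e in simp)
    then obtain n0 where n0: "\<And>n. n \<ge> n0 \<Longrightarrow> (norm (x - m n))\<^sup>2 - d\<^sup>2 < e\<^sup>2 / 4"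
      by (auto simp: eventually_sequentially)
    have "dist (m i) (m j) < e" if "i \<ge> n0" "j \<ge> n0" for i j
    proof -
      have "(norm (m i - m j))\<^sup>2 < e\<^sup>2"
        using par[of i j] n0[OF that(1)] n0[OF that(2)] by simp
      then show ?thesis
        unfolding dist_norm using e by (simp add: power_less_imp_less_base)
    qed
    then show "\<exists>n0. \<forall>i\<ge>n0. \<forall>j\<ge>n0. dist (m i) (m j) < e" by blast
  qed
  then obtain y where y: "m \<longlonglongrightarrow> y"
    using Cauchy_convergent convergent_def by blast
  have yM: "y \<in> M"
    using closed_sequentially[OF closed _ y] m(1) by auto
  define z where "z = x - y"
  have nz: "norm z = d"
    using LIMSEQ_unique[OF lim tendsto_norm[OF tendsto_diff[OF tendsto_const y]]] by (simp add: z_def)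
  have "cinner v z = 0" if v: "v \<in> M" for v
  proof (cases "v = 0")
    case False
    define a where "a = cinner z v / complex_of_real ((norm v)\<^sup>2)"
    have "d \<le> norm (x - (y + a *\<^sub>C v))"
      by (intro d add scale yM v)
    then have "(norm z)\<^sup>2 \<le> (norm (z - a *\<^sub>C v))\<^sup>2"
      using nz d0 by (intro power_mono) (auto simp: z_def diff_diff_eq)
    also have "\<dots> = (norm z)\<^sup>2 - 2 * Re (cnj a * cinner z v) + (cmod a * norm v)\<^sup>2"
      by (simp add: norm_diff_squared cinner_scaleC_right norm_scaleC)
    also have "cnj a * cinner z v = complex_of_real ((cmod (cinner z v))\<^sup>2 / (norm v)\<^sup>2)"
      using complex_norm_square[of "cinner z v"] by (simp add: a_def mult.commute)
    also have "(cmod a * norm v)\<^sup>2 = (cmod (cinner z v))\<^sup>2 / (norm v)\<^sup>2"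
      using False by (simp add: a_def norm_divide norm_power power_mult_distrib power_divide)
        (simp add: power2_eq_square power4_eq_xxxx)
    finally have "(cmod (cinner z v))\<^sup>2 / (norm v)\<^sup>2 \<le> 0"
      by (simp only: Re_complex_of_real)
    then have "cinner z v = 0"
      using False by (simp add: divide_le_0_iff)
    then show ?thesis by (metis cinner_commute complex_cnj_zero)
  qed simp
  moreover have "z \<noteq> 0"
    using x yM by (auto simp: z_def)
  ultimately show ?thesis using that by blast
qed

text \<open>
  A vector \<open>z\<close> orthogonal to the kernel represents \<open>f\<close> up to a factor, since \<open>x - (f x / f z) z\<close> lies
  in the kernel.
\<close>

lemma riesz_representation:
  fixes f :: "'a::complex_hilbert \<Rightarrow> complex"
  assumes f: "bounded_linear f" and fC: "\<And>a x. f (a *\<^sub>C x) = a * f x"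
  obtains y where "\<And>x. f x = cinner x y"
proof (cases "\<forall>x. f x = 0")
  case True
  then show ?thesis using that[of 0] by simp
next
  case False
  interpret f: bounded_linear f by fact
  let ?M = "{x. f x = 0}"
  obtain x0 where x0: "f x0 \<noteq> 0" using False by auto
  have "closed ?M"
    by (intro closed_Collect_eq continuous_intros f.continuous_on)
  then obtain z where z: "z \<noteq> 0" "\<And>m. f m = 0 \<Longrightarrow> cinner m z = 0"
    by (rule orthogonal_vector_exists[of ?M x0]) (use x0 in \<open>auto simp: f.add fC f.zero\<close>)
  have fz: "f z \<noteq> 0"
    using z cinner_self_eq_0 by blast
  have "f x = cinner x (cnj (f z / complex_of_real ((norm z)\<^sup>2)) *\<^sub>C z)" for x
  proof -
    have "cinner (x - (f x / f z) *\<^sub>C z) z = 0"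
      by (rule z(2)) (simp add: f.diff fC fz)
    then have "cinner x z = f x / f z * complex_of_real ((norm z)\<^sup>2)"
      by (simp add: cinner_diff_left cinner_scaleC_left cinner_self)
    then show ?thesis
      using fz z(1) by (simp add: cinner_scaleC_right)
  qed
  then show ?thesis using that by blast
qed

subsection \<open>Adjoints of bounded operators\<close>

text \<open>
  By choice, to avoid a type of bounded operators; \<open>cinner_adj\<close> is the defining property.
\<close>

definition adj :: "('a::complex_hilbert \<Rightarrow> 'a) \<Rightarrow> 'a \<Rightarrow> 'a" where
  "adj f = (SOME g. \<forall>x y. cinner (f x) y = cinner x (g y))"

lemma cinner_adj:
  assumes "bounded_clinear f"
  shows "cinner (f x) y = cinner x (adj f y)"
proof -
  interpret f: bounded_linear f
    using assms by (simp add: bounded_clinear_def)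
  have "\<exists>g. \<forall>x. cinner (f x) y = cinner x g" for y
  proof -
    have "bounded_linear (\<lambda>x. cinner (f x) y)"
      by (rule bounded_linear_compose[OF bounded_linear_cinner_left f.bounded_linear_axioms])
    moreover have "cinner (f (a *\<^sub>C x)) y = a * cinner (f x) y" for a x
      using assms by (simp add: bounded_clinear_def cinner_scaleC_left)
    ultimately show ?thesis
      by (rule riesz_representation[of "\<lambda>x. cinner (f x) y"]) blast
  qed
  then have "\<exists>g. \<forall>x y. cinner (f x) y = cinner x (g y)" by metis
  then show ?thesis
    unfolding adj_def by (rule someI2_ex) blast
qed

lemma norm_adj_le:
  assumes "bounded_clinear f" and le: "\<And>x. norm (f x) \<le> M * norm x"
  shows "norm (adj f y) \<le> M * norm y"
proof (cases "adj f y = 0")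
  case False
  have "(norm (adj f y))\<^sup>2 = cmod (cinner (f (adj f y)) y)"
    by (simp add: cinner_adj[OF assms(1)] cinner_self norm_power)
  also have "\<dots> \<le> norm (f (adj f y)) * norm y"
    by (rule norm_cinner_le)
  also have "\<dots> \<le> (M * norm (adj f y)) * norm y"
    by (intro mult_right_mono le) simp
  finally show ?thesis
    using False by (simp add: power2_eq_square mult.assoc mult.left_commute)
next
  case True
  have "0 \<le> M * norm y"
    using le[of y] norm_ge_zero order_trans by blast
  then show ?thesis using True by simp
qed

lemma bounded_clinear_adj:
  assumes "bounded_clinear f"
  shows "bounded_clinear (adj f)"
proof -
  interpret f: bounded_linear f
    using assms by (simp add: bounded_clinear_def)
  obtain M where M: "\<And>x. norm (f x) \<le> M * norm x"
    using f.bounded by (auto simp: mult.commute)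
  have C: "adj f (a *\<^sub>C x) = a *\<^sub>C adj f x" for a x
    by (rule cinner_eqI) (simp add: cinner_adj[OF assms, symmetric] cinner_scaleC_right)
  have "bounded_linear (adj f)"
  proof (rule bounded_linear_intro)
    show "adj f (x + y) = adj f x + adj f y" for x y
      by (rule cinner_eqI) (simp add: cinner_adj[OF assms, symmetric] cinner_add_right)
    show "adj f (r *\<^sub>R x) = r *\<^sub>R adj f x" for r x
      by (metis C scaleC_of_real)
    show "norm (adj f x) \<le> norm x * M" for x
      using norm_adj_le[OF assms M] by (simp add: mult.commute)
  qed
  with C show ?thesis by (simp add: bounded_clinear_def)
qed

section \<open>Uniform boundedness\<close>

text \<open>
  By Baire's theorem one of the closed sets on which the family is bounded by \<open>n\<close> contains a ball;
  linearity moves the ball to the origin.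
\<close>

lemma uniform_boundedness:
  fixes F :: "('a::banach \<Rightarrow> 'b::real_normed_vector) set"
  assumes lin: "\<And>f. f \<in> F \<Longrightarrow> bounded_linear f"
    and pointwise: "\<And>x. \<exists>K. \<forall>f\<in>F. norm (f x) \<le> K"
  obtains K where "K \<ge> 0" "\<And>f x. f \<in> F \<Longrightarrow> norm (f x) \<le> K * norm x"
proof -
  define C where "C n = {x. \<forall>f\<in>F. norm (f x) \<le> real n}" for n
  have closed: "closed (C n)" for n
  proof -
    have "C n = (\<Inter>f\<in>F. {x. norm (f x) \<le> real n})"
      by (auto simp: C_def)
    also have "closed \<dots>"
      by (intro closed_INT ballI closed_Collect_le continuous_intros
          linear_continuous_on lin)
    finally show ?thesis .
  qed
  have cover: "(\<Union>n. C n) = UNIV"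
  proof (intro set_eqI iffI UNIV_I)
    fix x
    obtain K where K: "\<forall>f\<in>F. norm (f x) \<le> K" using pointwise by blast
    have "K \<le> real (nat \<lceil>K\<rceil>)" by linarith
    then have "x \<in> C (nat \<lceil>K\<rceil>)"
      using K by (auto simp: C_def intro: order_trans)
    then show "x \<in> (\<Union>n. C n)" by blast
  qed
  have "\<exists>n. interior (C n) \<noteq> {}"
  proof (rule ccontr)
    assume "\<not> ?thesis"
    then have "euclidean interior_of \<Union> (range C) = {}"
      using closed
      by (intro Baire_category_alt disjI1 completely_metrizable_space_euclidean)
        auto
    then show False using cover by simp
  qed
  then obtain n x0 where "x0 \<in> interior (C n)" by blast
  then obtain r where r: "r > 0" "cball x0 r \<subseteq> C n"
    by (metis mem_interior_cball)
  have "norm (f x) \<le> (2 * real n / r) * norm x" if f: "f \<in> F" for f x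
  proof (cases "x = 0")
    case True
    then show ?thesis using lin[OF f] by (simp add: linear_simps)
  next
    case False
    interpret f: bounded_linear f by (rule lin[OF f])
    have "x0 \<in> C n" "x0 + (r / norm x) *\<^sub>R x \<in> C n"
      using r False by (auto simp: dist_norm)
    then have "norm (f x0) \<le> n" "norm (f (x0 + (r / norm x) *\<^sub>R x)) \<le> n"
      using f by (auto simp: C_def)
    then have "norm (f (x0 + (r / norm x) *\<^sub>R x) - f x0) \<le> 2 * real n"
      using norm_triangle_ineq4[of "f (x0 + (r / norm x) *\<^sub>R x)" "f x0"] by linarith
    then show ?thesis
      using r False by (simp add: f.add f.scaleR field_simps)
  qed
  then show ?thesis using that[of "2 * real n / r"] r by auto
qed

text \<open>
  This is uniform boundedness of the real-linear functionals \<open>u \<mapsto> \<langle>x, u\<rangle>\<close>, whose norm is \<open>\<parallel>x\<parallel>\<close>.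
\<close>

lemma weakly_bounded_imp_bounded:
  fixes X :: "'a::complex_hilbert set"
  assumes "\<And>u. \<exists>K. \<forall>x\<in>X. cmod (cinner x u) \<le> K"
  obtains K where "K \<ge> 0" "\<And>x. x \<in> X \<Longrightarrow> norm x \<le> K"
proof -
  let ?F = "cinner ` X"
  obtain K where K: "K \<ge> 0" "\<And>f u. f \<in> ?F \<Longrightarrow> norm (f u) \<le> K * norm u"
    by (rule uniform_boundedness[of ?F])
      (use assms in \<open>auto simp: bounded_linear_cinner_right\<close>)
  have "norm x \<le> K" if "x \<in> X" for x
  proof (cases "x = 0")
    case False
    have "norm x * norm x \<le> K * norm x"
      using K(2)[of "cinner x" x] that
      by (simp add: cinner_self norm_power del: of_real_power) (simp add: power2_eq_square)
    then show ?thesis using False by simp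
  qed (use K in simp)
  then show ?thesis using that K(1) by blast
qed

text \<open>
  The Hellinger-Toeplitz theorem: the image of the unit ball is weakly bounded, because
  \<open>\<bar>\<langle>f x, u\<rangle>\<bar> = \<bar>\<langle>x, f u\<rangle>\<bar> \<le> \<parallel>f u\<parallel>\<close> for \<open>\<parallel>x\<parallel> \<le> 1\<close>.
\<close>

lemma symmetric_bounded_linear:
  fixes f :: "'a::complex_hilbert \<Rightarrow> 'a"
  assumes sym: "\<And>x y. cinner (f x) y = cinner x (f y)"
  shows "bounded_linear f"
proof -
  have scale: "f (r *\<^sub>R x) = r *\<^sub>R f x" for r x
    by (rule cinner_eqI) (simp add: sym [symmetric] cinner_scaleR_right)
  obtain K where K: "K \<ge> 0" "\<And>y. y \<in> f ` cball 0 1 \<Longrightarrow> norm y \<le> K"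
  proof (rule weakly_bounded_imp_bounded[of "f ` cball 0 1"])
    fix u
    have "cmod (cinner (f x) u) \<le> norm (f u)" if "norm x \<le> 1" for x
    proof -
      have "cmod (cinner (f x) u) \<le> norm x * norm (f u)"
        by (simp add: sym norm_cinner_le)
      also have "\<dots> \<le> norm (f u)"
        using that by (simp add: mult_left_le_one_le)
      finally show ?thesis .
    qed
    then show "\<exists>K. \<forall>x\<in>f ` cball 0 1. cmod (cinner x u) \<le> K"
      by (intro exI[of _ "norm (f u)"]) auto
  qed blast
  show ?thesis
  proof (rule bounded_linear_intro)
    show "f (x + y) = f x + f y" for x y
      by (rule cinner_eqI) (simp add: sym [symmetric] cinner_add_right)
    show "norm (f x) \<le> norm x * K" for x
    proof (cases "x = 0")
      case False
      have "norm (f ((1 / norm x) *\<^sub>R x)) \<le> K"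
        by (rule K(2)) (use False in auto)
      then show ?thesis using False by (simp add: scale field_simps)
    qed (use scale[of 0 0] in simp)
  qed (rule scale)
qed

section \<open>Strongly continuous semigroups\<close>

lemma C0_semigroup_bounded_clinear: "C0_semigroup T \<Longrightarrow> 0 \<le> t \<Longrightarrow> bounded_clinear (T t)"
  by (simp add: C0_semigroup_def)

lemma C0_semigroup_bounded_linear: "C0_semigroup T \<Longrightarrow> 0 \<le> t \<Longrightarrow> bounded_linear (T t)"
  by (simp add: C0_semigroup_def bounded_clinear_def)

lemma C0_semigroup_scaleC: "C0_semigroup T \<Longrightarrow> 0 \<le> t \<Longrightarrow> T t (a *\<^sub>C x) = a *\<^sub>C T t x"
  by (simp add: C0_semigroup_def bounded_clinear_def)

lemma C0_semigroup_0: "C0_semigroup T \<Longrightarrow> T 0 x = x"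
  by (simp add: C0_semigroup_def)

lemma C0_semigroup_add: "C0_semigroup T \<Longrightarrow> 0 \<le> s \<Longrightarrow> 0 \<le> t \<Longrightarrow> T (s + t) x = T s (T t x)"
  by (simp add: C0_semigroup_def)

lemma C0_semigroup_tendsto_0:
  assumes T: "C0_semigroup T" and f: "(f \<longlongrightarrow> 0) F" and nonneg: "\<forall>\<^sub>F n in F. 0 \<le> f n"
  shows "((\<lambda>n. T (f n) x) \<longlongrightarrow> x) F"
proof -
  have "((\<lambda>t. T t x) \<longlongrightarrow> T 0 x) (at_right 0)"
    using T by (simp add: C0_semigroup_def)
  then have "((\<lambda>t. T t x) \<longlongrightarrow> T 0 x) (at 0 within {0..1})"
    by (simp add: at_within_Icc_at_right)
  then have "continuous (at 0 within {0..1}) (\<lambda>t. T t x)"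
    by (simp add: continuous_within)
  moreover have "\<forall>\<^sub>F n in F. f n \<in> {0..1}"
    using nonneg order_tendstoD(2)[OF f zero_less_one] by eventually_elim auto
  ultimately have "((\<lambda>n. T (f n) x) \<longlongrightarrow> T 0 x) F"
    using f by (rule continuous_within_tendsto_compose)
  then show ?thesis by (simp add: C0_semigroup_0[OF T])
qed

text \<open>
  Near \<open>0\<close> this is the uniform boundedness principle, applied to a sequence of times converging
  to \<open>0\<close>; the semigroup law propagates the bound to compact intervals.
\<close>

lemma C0_semigroup_bounded_Icc:
  assumes T: "C0_semigroup T"
  obtains M where "M \<ge> 0" "\<And>t x. 0 \<le> t \<Longrightarrow> t \<le> b \<Longrightarrow> norm (T t x) \<le> M * norm x"
proof -
  have "\<exists>\<delta>>0. \<exists>M\<ge>0. \<forall>t\<in>{0..\<delta>}. \<forall>x. norm (T t x) \<le> M * norm x"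
  proof (rule ccontr)
    assume neg: "\<not> ?thesis"
    have "\<exists>t\<in>{0..1 / real (Suc n)}. \<exists>x. norm (T t x) > real n * norm x" for n
      using neg of_nat_0_le_iff[of n] by (metis divide_pos_pos not_le of_nat_0_less_iff zero_less_Suc zero_less_one)
    then obtain t where t: "\<And>n. t n \<in> {0..1 / real (Suc n)}"
      and ex: "\<And>n. \<exists>x. norm (T (t n) x) > real n * norm x"
      by metis
    have t0: "t \<longlonglongrightarrow> 0"
      by (rule tendsto_sandwich[OF _ _ tendsto_const LIMSEQ_Suc[OF lim_inverse_n']])
        (use t in auto)
    obtain K where K: "\<And>f x. f \<in> range (\<lambda>n. T (t n)) \<Longrightarrow> norm (f x) \<le> K * norm x"
    proof (rule uniform_boundedness[of "range (\<lambda>n. T (t n))"])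
      show "bounded_linear f" if "f \<in> range (\<lambda>n. T (t n))" for f
        using that t C0_semigroup_bounded_linear[OF T] by auto
      fix x
      have "(\<lambda>n. T (t n) x) \<longlonglongrightarrow> x"
        using t by (intro C0_semigroup_tendsto_0[OF T t0]) auto
      then have "Bseq (\<lambda>n. T (t n) x)"
        by (rule convergent_imp_Bseq[OF convergentI])
      then show "\<exists>K. \<forall>f\<in>range (\<lambda>n. T (t n)). norm (f x) \<le> K"
        by (auto simp: Bseq_def)
    qed blast
    obtain n where n: "K \<le> real n" using real_arch_simple by blast
    obtain x where "norm (T (t n) x) > real n * norm x" using ex by blast
    moreover have "norm (T (t n) x) \<le> K * norm x" by (rule K) blast
    moreover have "K * norm x \<le> real n * norm x" by (intro mult_right_mono n) simp
    ultimately show False by linarith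
  qed
  then obtain \<delta> M where \<delta>: "\<delta> > 0" and M: "M \<ge> 0"
    "\<And>t x. 0 \<le> t \<Longrightarrow> t \<le> \<delta> \<Longrightarrow> norm (T t x) \<le> M * norm x"
    by auto
  have pow: "norm (T t x) \<le> M ^ n * norm x" if "0 \<le> t" "t \<le> real n * \<delta>" for n t x
    using that
  proof (induction n arbitrary: t)
    case 0
    then show ?case by (simp add: C0_semigroup_0[OF T])
  next
    case (Suc n)
    let ?m = "min t \<delta>"
    have "T (?m + (t - ?m)) x = T ?m (T (t - ?m) x)"
      using Suc.prems \<delta> by (intro C0_semigroup_add[OF T]) auto
    then have "norm (T t x) \<le> M * norm (T (t - ?m) x)"
      using Suc.prems \<delta> M(2)[of ?m "T (t - ?m) x"] by simp
    also have "\<dots> \<le> M * (M ^ n * norm x)"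
      using Suc.prems \<delta> M by (intro mult_left_mono Suc.IH) (auto simp: algebra_simps min_def)
    finally show ?case by (simp add: mult.assoc)
  qed
  obtain n where "b / \<delta> \<le> real n" using real_arch_simple by blast
  then have "b \<le> real n * \<delta>" using \<delta> by (simp add: field_simps)
  then show ?thesis
    using M pow by (intro that[of "M ^ n"]) auto
qed

text \<open>
  Reduces increments at arbitrary times to increments at \<open>0\<close>, from either side at once.
\<close>

lemma C0_semigroup_diff:
  assumes T: "C0_semigroup T" and "0 \<le> r" "0 \<le> s"
  shows "T r x - T s x = sgn (r - s) *\<^sub>R T (min r s) (T \<bar>r - s\<bar> x - x)"
proof -
  interpret bounded_linear "T (min r s)"
    using assms by (intro C0_semigroup_bounded_linear) auto
  have diff_min: "T (min r s) (T \<bar>r - s\<bar> x - x) = T (min r s) (T \<bar>r - s\<bar> x) - T (min r s) x"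
    by (rule diff)
  have "T (min r s + \<bar>r - s\<bar>) x = T (min r s) (T \<bar>r - s\<bar> x)"
    using assms by (intro C0_semigroup_add) auto
  moreover have "min r s + \<bar>r - s\<bar> = max r s" by auto
  ultimately show ?thesis
    unfolding diff_min by (cases r s rule: linorder_cases) (auto simp: min_def max_def)
qed

text \<open>
  Joint continuity in time and vector, from the bound on compact time intervals.
\<close>

lemma C0_semigroup_tendsto:
  assumes T: "C0_semigroup T" and f: "(f \<longlongrightarrow> t) F" and g: "(g \<longlongrightarrow> x) F"
    and nonneg: "\<forall>\<^sub>F n in F. 0 \<le> f n" and t: "0 \<le> t"
  shows "((\<lambda>n. T (f n) (g n)) \<longlongrightarrow> T t x) F"
proof -
  obtain M where M: "M \<ge> 0" "\<And>s x. 0 \<le> s \<Longrightarrow> s \<le> t + 1 \<Longrightarrow> norm (T s x) \<le> M * norm x"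
    using C0_semigroup_bounded_Icc[OF T, of "t + 1"] by metis
  have abs: "((\<lambda>n. \<bar>f n - t\<bar>) \<longlongrightarrow> 0) F"
    using tendsto_rabs[OF tendsto_diff[OF f tendsto_const[of t]]] by simp
  have "((\<lambda>n. T \<bar>f n - t\<bar> x - x) \<longlongrightarrow> 0) F"
    using tendsto_diff[OF C0_semigroup_tendsto_0[OF T abs, of x] tendsto_const[of x]] by simp
  moreover have "((\<lambda>n. g n - x) \<longlongrightarrow> 0) F"
    using tendsto_diff[OF g tendsto_const[of x]] by simp
  ultimately have
    "((\<lambda>n. M * norm (g n - x) + M * norm (T \<bar>f n - t\<bar> x - x)) \<longlongrightarrow> M * norm (0::'a) + M * norm (0::'a)) F"
    by (intro tendsto_intros)
  then have lim: "((\<lambda>n. M * norm (g n - x) + M * norm (T \<bar>f n - t\<bar> x - x)) \<longlongrightarrow> 0) F"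
    by simp
  have "\<forall>\<^sub>F n in F. norm (T (f n) (g n) - T t x)
      \<le> M * norm (g n - x) + M * norm (T \<bar>f n - t\<bar> x - x)"
    using nonneg order_tendstoD(2)[OF f less_add_one]
  proof eventually_elim
    case (elim n)
    interpret bounded_linear "T (f n)"
      using elim by (intro C0_semigroup_bounded_linear[OF T])
    have "T (f n) (g n) - T t x = T (f n) (g n - x) + (T (f n) x - T t x)"
      by (simp add: diff)
    then have "norm (T (f n) (g n) - T t x) \<le> norm (T (f n) (g n - x)) + norm (T (f n) x - T t x)"
      by (metis norm_triangle_ineq)
    moreover have "norm (T (f n) (g n - x)) \<le> M * norm (g n - x)"
      using elim by (intro M) auto
    moreover have "norm (T (f n) x - T t x) \<le> norm (T (min (f n) t) (T \<bar>f n - t\<bar> x - x))"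
      unfolding C0_semigroup_diff[OF T elim(1) t, of x] norm_scaleR
      by (rule mult_left_le_one_le) (auto simp: sgn_if)
    moreover have "\<dots> \<le> M * norm (T \<bar>f n - t\<bar> x - x)"
      using elim t by (intro M) auto
    ultimately show ?case by linarith
  qed
  then have "((\<lambda>n. T (f n) (g n) - T t x) \<longlongrightarrow> 0) F"
    by (rule Lim_null_comparison[OF _ lim])
  then show ?thesis by (simp add: LIM_zero_iff)
qed

lemma C0_semigroup_continuous_on:
  assumes T: "C0_semigroup T" and "continuous_on S g" "S \<subseteq> {0..}"
  shows "continuous_on S (\<lambda>t. T t (g t))"
  unfolding continuous_on_def
proof
  fix s assume s: "s \<in> S"
  show "((\<lambda>t. T t (g t)) \<longlongrightarrow> T s (g s)) (at s within S)"
    using assms(2,3) s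
    by (intro C0_semigroup_tendsto[OF T tendsto_ident_at])
      (auto simp: continuous_on_def eventually_at_filter intro!: always_eventually)
qed

subsection \<open>The generator\<close>

lemma generatorD: "(x, y) \<in> generator T \<Longrightarrow> ((\<lambda>t. (1 / t) *\<^sub>R (T t x - x)) \<longlongrightarrow> y) (at_right 0)"
  by (simp add: generator_def)

lemma generator_invariant:
  assumes T: "C0_semigroup T" and xy: "(x, y) \<in> generator T" and t: "0 \<le> t"
  shows "(T t x, T t y) \<in> generator T"
proof -
  interpret bounded_linear "T t" by (rule C0_semigroup_bounded_linear[OF T t])
  have "((\<lambda>h. T t ((1 / h) *\<^sub>R (T h x - x))) \<longlongrightarrow> T t y) (at_right 0)"
    by (rule tendsto[OF generatorD[OF xy]])
  moreover have "\<forall>\<^sub>F h in at_right 0. T t ((1 / h) *\<^sub>R (T h x - x)) = (1 / h) *\<^sub>R (T h (T t x) - T t x)"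
    unfolding eventually_at_right_field
  proof (intro exI[of _ "1::real"] conjI allI impI)
    fix h :: real assume "0 < h"
    then have "T t (T h x) = T h (T t x)"
      using C0_semigroup_add[OF T, of t h x] C0_semigroup_add[OF T, of h t x] t
      by (simp add: add.commute)
    then show "T t ((1 / h) *\<^sub>R (T h x - x)) = (1 / h) *\<^sub>R (T h (T t x) - T t x)"
      by (simp add: scaleR diff)
  qed simp
  ultimately show ?thesis
    unfolding generator_def by (simp add: tendsto_cong)
qed

lemma has_vector_derivative_iff_slope:
  "(f has_vector_derivative D) (at s within S)
    \<longleftrightarrow> ((\<lambda>r. (1 / (r - s)) *\<^sub>R (f r - f s)) \<longlongrightarrow> D) (at s within S)"
proof -
  have "(f has_vector_derivative D) (at s within S)
      \<longleftrightarrow> ((\<lambda>r. norm ((f r - f s) - (r - s) *\<^sub>R D) / norm (r - s)) \<longlongrightarrow> 0) (at s within S)"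
    unfolding has_vector_derivative_def has_derivative_iff_norm
    by (simp add: bounded_linear_scaleR_left)
  also have "\<dots> \<longleftrightarrow> ((\<lambda>r. norm ((1 / (r - s)) *\<^sub>R (f r - f s) - D)) \<longlongrightarrow> 0) (at s within S)"
  proof (rule tendsto_cong)
    have "norm ((f r - f s) - (r - s) *\<^sub>R D) / norm (r - s)
        = norm ((1 / (r - s)) *\<^sub>R (f r - f s) - D)" if "r \<noteq> s" for r
    proof -
      have "(1 / (r - s)) *\<^sub>R (f r - f s) - D = (1 / (r - s)) *\<^sub>R ((f r - f s) - (r - s) *\<^sub>R D)"
        using that by (simp add: scaleR_diff_right)
      then show ?thesis by simp
    qed
    then show "\<forall>\<^sub>F r in at s within S. norm ((f r - f s) - (r - s) *\<^sub>R D) / norm (r - s)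
        = norm ((1 / (r - s)) *\<^sub>R (f r - f s) - D)"
      by (simp add: eventually_at_filter)
  qed
  also have "\<dots> \<longleftrightarrow> ((\<lambda>r. (1 / (r - s)) *\<^sub>R (f r - f s)) \<longlongrightarrow> D) (at s within S)"
    by (simp add: tendsto_norm_zero_iff LIM_zero_iff)
  finally show ?thesis .
qed

text \<open>
  The difference quotient at \<open>s\<close> is \<open>T (min r s)\<close> applied to the difference quotient at \<open>0\<close> over
  \<open>\<bar>r - s\<bar>\<close>, so that one-sided differentiability at \<open>0\<close> gives two-sided differentiability.
\<close>

lemma generator_has_vector_derivative:
  assumes T: "C0_semigroup T" and xy: "(x, y) \<in> generator T" and s: "0 \<le> s"
  shows "((\<lambda>r. T r x) has_vector_derivative T s y) (at s within {0..})"
  unfolding has_vector_derivative_iff_slope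
proof -
  let ?F = "at s within {0..}"
  have "((\<lambda>r. \<bar>r - s\<bar>) \<longlongrightarrow> \<bar>s - s\<bar>) ?F"
    by (intro tendsto_intros)
  then have "filterlim (\<lambda>r. \<bar>r - s\<bar>) (at_right 0) ?F"
    unfolding filterlim_at by (simp add: eventually_at_filter)
  with generatorD[OF xy]
  have "((\<lambda>r. (1 / \<bar>r - s\<bar>) *\<^sub>R (T \<bar>r - s\<bar> x - x)) \<longlongrightarrow> y) ?F"
    by (rule filterlim_compose)
  moreover have "((\<lambda>r. min r s) \<longlongrightarrow> min s s) ?F"
    by (intro tendsto_intros)
  ultimately have "((\<lambda>r. T (min r s) ((1 / \<bar>r - s\<bar>) *\<^sub>R (T \<bar>r - s\<bar> x - x))) \<longlongrightarrow> T s y) ?F"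
    using s by (intro C0_semigroup_tendsto[OF T]) (auto simp: eventually_at_filter)
  moreover have "\<forall>\<^sub>F r in ?F. T (min r s) ((1 / \<bar>r - s\<bar>) *\<^sub>R (T \<bar>r - s\<bar> x - x))
      = (1 / (r - s)) *\<^sub>R (T r x - T s x)"
  proof -
    have "T (min r s) ((1 / \<bar>r - s\<bar>) *\<^sub>R (T \<bar>r - s\<bar> x - x)) = (1 / (r - s)) *\<^sub>R (T r x - T s x)"
      if "r \<noteq> s" "0 \<le> r" for r
    proof -
      interpret bounded_linear "T (min r s)"
        using that s by (intro C0_semigroup_bounded_linear[OF T]) auto
      have "1 / \<bar>r - s\<bar> = (1 / (r - s)) * sgn (r - s)"
        using that by (auto simp: sgn_if abs_if field_simps)
      then show ?thesis
        using that s by (simp add: scaleR C0_semigroup_diff[OF T])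
    qed
    then show ?thesis by (simp add: eventually_at_filter)
  qed
  ultimately show "((\<lambda>r. (1 / (r - s)) *\<^sub>R (T r x - T s x)) \<longlongrightarrow> T s y) ?F"
    by (rule Lim_transform_eventually)
qed

lemma C0_semigroup_integrable:
  assumes "C0_semigroup T" "0 \<le> a"
  shows "(\<lambda>s. T s x) integrable_on {a..b}"
  by (intro integrable_continuous_real C0_semigroup_continuous_on[OF assms(1) continuous_on_const])
    (use assms(2) in auto)

lemma integral_generator:
  assumes T: "C0_semigroup T" and xy: "(x, y) \<in> generator T" and t: "0 \<le> t"
  shows "integral {0..t} (\<lambda>s. T s y) = T t x - x"
proof -
  have "((\<lambda>s. T s y) has_integral (T t x - T 0 x)) {0..t}"
    by (intro fundamental_theorem_of_calculus t
        has_vector_derivative_within_subset[OF generator_has_vector_derivative[OF T xy]]) auto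
  then show ?thesis by (simp add: C0_semigroup_0[OF T] integral_unique)
qed

lemma C0_semigroup_integral_mean:
  assumes T: "C0_semigroup T" and t: "0 \<le> t"
  shows "((\<lambda>h. (1 / h) *\<^sub>R integral {t..t + h} (\<lambda>s. T s x)) \<longlongrightarrow> T t x) (at_right 0)"
proof -
  let ?I = "\<lambda>u. integral {t..u} (\<lambda>s. T s x)"
  have "(?I has_vector_derivative T t x) (at t within {t..t + 1})"
    using t by (intro integral_has_vector_derivative
        C0_semigroup_continuous_on[OF T continuous_on_const]) auto
  then have "((\<lambda>r. (1 / (r - t)) *\<^sub>R ?I r) \<longlongrightarrow> T t x) (at_right t)"
    by (simp add: has_vector_derivative_iff_slope at_within_Icc_at_right)
  moreover have "filterlim (\<lambda>h. t + h) (at_right t) (at_right 0)"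
    unfolding filterlim_at
    by (intro conjI tendsto_eq_intros) (auto simp: eventually_at_filter)
  ultimately show ?thesis
    using filterlim_compose[of "\<lambda>r. (1 / (r - t)) *\<^sub>R ?I r"] by fastforce
qed

text \<open>
  The operator \<open>T h\<close> shifts the interval of integration to \<open>[h, t + h]\<close>, so that the difference quotient
  is the mean of the orbit over \<open>[t, t + h]\<close> minus its mean over \<open>[0, h]\<close>.
\<close>

lemma integral_in_generator:
  assumes T: "C0_semigroup T" and t: "0 \<le> t"
  shows "(integral {0..t} (\<lambda>s. T s x), T t x - x) \<in> generator T"
proof -
  let ?I = "\<lambda>a b. integral {a..b} (\<lambda>s. T s x)"
  have "((\<lambda>h. (1 / h) *\<^sub>R ?I t (t + h) - (1 / h) *\<^sub>R ?I 0 (0 + h)) \<longlongrightarrow> T t x - T 0 x) (at_right 0)"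
    using t by (intro tendsto_diff C0_semigroup_integral_mean[OF T]) auto
  moreover have "\<forall>\<^sub>F h in at_right 0. (1 / h) *\<^sub>R ?I t (t + h) - (1 / h) *\<^sub>R ?I 0 (0 + h)
      = (1 / h) *\<^sub>R (T h (?I 0 t) - ?I 0 t)"
    unfolding eventually_at_right_field
  proof (intro exI[of _ "1::real"] conjI allI impI)
    fix h :: real assume h: "0 < h"
    have "T h (?I 0 t) = integral {0..t} (T h \<circ> (\<lambda>s. T s x))"
      using h by (intro integral_linear[symmetric] C0_semigroup_integrable[OF T]
          C0_semigroup_bounded_linear[OF T]) auto
    also have "\<dots> = integral {0..t} ((\<lambda>s. T s x) \<circ> (+) h)"
      using h by (intro integral_cong) (simp add: C0_semigroup_add[OF T])
    also have "\<dots> = ?I h (t + h)"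
      by (simp add: integral_shift_Icc_real)
    finally have "T h (?I 0 t) = ?I h (t + h)" .
    moreover have "?I 0 h + ?I h (t + h) = ?I 0 (t + h)"
      using h t by (intro Henstock_Kurzweil_Integration.integral_combine C0_semigroup_integrable[OF T]) auto
    moreover have "?I 0 t + ?I t (t + h) = ?I 0 (t + h)"
      using h t by (intro Henstock_Kurzweil_Integration.integral_combine C0_semigroup_integrable[OF T]) auto
    ultimately have "T h (?I 0 t) - ?I 0 t = ?I t (t + h) - ?I 0 h"
      by (simp add: algebra_simps)
    then show "(1 / h) *\<^sub>R ?I t (t + h) - (1 / h) *\<^sub>R ?I 0 (0 + h)
        = (1 / h) *\<^sub>R (T h (?I 0 t) - ?I 0 t)"
      by (simp add: scaleR_diff_right)
  qed simp
  ultimately show ?thesis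
    unfolding generator_def by (simp add: tendsto_cong C0_semigroup_0[OF T])
qed

text \<open>
  On the domain of the generator, \<open>T (t - s) (S s x)\<close> has derivative \<open>0\<close> in \<open>s\<close>, so its values
  \<open>T t x\<close> and \<open>S t x\<close> at the end points agree; the domain is dense.
\<close>

lemma semigroup_unique:
  assumes T: "C0_semigroup T" and S: "C0_semigroup S" and gen: "generator T = generator S"
    and t: "0 \<le> t"
  shows "T t x = S t x"
proof -
  have dom: "T t x = S t x" if xy: "(x, y) \<in> generator T" for x y
  proof -
    have xyS: "(x, y) \<in> generator S" using xy gen by simp
    let ?g = "\<lambda>s. T (t - s) (S s x)"
    have "(?g has_vector_derivative 0) (at s within {0..t})" if s: "s \<in> {0..t}" for s
      unfolding has_vector_derivative_iff_slope
    proof -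
      let ?F = "at s within {0..t}"
      have "((\<lambda>r. S r x) has_vector_derivative S s y) ?F"
        by (rule has_vector_derivative_within_subset[OF generator_has_vector_derivative[OF S xyS]])
          (use s in auto)
      then have lim1: "((\<lambda>r. T (t - r) ((1 / (r - s)) *\<^sub>R (S r x - S s x))) \<longlongrightarrow> T (t - s) (S s y)) ?F"
        using s by (intro C0_semigroup_tendsto[OF T])
          (auto simp: has_vector_derivative_iff_slope eventually_at_filter intro!: tendsto_intros)
      have "(S s x, S s y) \<in> generator T"
        using generator_invariant[OF S xyS] gen s by simp
      then have "((\<lambda>r. T r (S s x)) has_vector_derivative T (t - s) (S s y))
          (at (t - s) within (\<lambda>r. t - r) ` {0..t})"
        using s by (intro has_vector_derivative_within_subset[OF generator_has_vector_derivative[OF T]]) auto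
      moreover have "((\<lambda>r. t - r) has_vector_derivative - 1) ?F"
        by (auto intro!: derivative_eq_intros)
      ultimately have "((\<lambda>r. T (t - r) (S s x)) has_vector_derivative - T (t - s) (S s y)) ?F"
        using vector_diff_chain_within[of "\<lambda>r. t - r" "- 1" s "{0..t}" "\<lambda>r. T r (S s x)"]
        by (simp add: o_def)
      then have lim2: "((\<lambda>r. (1 / (r - s)) *\<^sub>R (T (t - r) (S s x) - T (t - s) (S s x)))
          \<longlongrightarrow> - T (t - s) (S s y)) ?F"
        by (simp add: has_vector_derivative_iff_slope)
      have "\<forall>\<^sub>F r in ?F. T (t - r) ((1 / (r - s)) *\<^sub>R (S r x - S s x))
          + (1 / (r - s)) *\<^sub>R (T (t - r) (S s x) - T (t - s) (S s x))
          = (1 / (r - s)) *\<^sub>R (?g r - ?g s)"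
      proof -
        have "T (t - r) ((1 / (r - s)) *\<^sub>R (S r x - S s x))
          + (1 / (r - s)) *\<^sub>R (T (t - r) (S s x) - T (t - s) (S s x))
          = (1 / (r - s)) *\<^sub>R (?g r - ?g s)" if "r \<in> {0..t}" for r
        proof -
          interpret bounded_linear "T (t - r)"
            using that by (intro C0_semigroup_bounded_linear[OF T]) auto
          show ?thesis by (simp add: scaleR diff algebra_simps)
        qed
        then show ?thesis by (simp add: eventually_at_filter)
      qed
      from Lim_transform_eventually[OF tendsto_add[OF lim1 lim2] this]
      show "((\<lambda>r. (1 / (r - s)) *\<^sub>R (?g r - ?g s)) \<longlongrightarrow> 0) ?F" by simp
    qed
    then obtain c where "\<And>s. s \<in> {0..t} \<Longrightarrow> ?g s = c"
      using has_vector_derivative_zero_constant[of "{0..t}" ?g] by auto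
    from this[of 0] this[of t] show ?thesis
      using t by (simp add: C0_semigroup_0[OF T] C0_semigroup_0[OF S])
  qed
  interpret Tt: bounded_linear "T t" by (rule C0_semigroup_bounded_linear[OF T t])
  interpret St: bounded_linear "S t" by (rule C0_semigroup_bounded_linear[OF S t])
  let ?m = "\<lambda>h. (1 / h) *\<^sub>R integral {0..h} (\<lambda>s. T s x)"
  have m: "(?m \<longlongrightarrow> x) (at_right 0)"
    using C0_semigroup_integral_mean[OF T, of 0 x] by (simp add: C0_semigroup_0[OF T])
  have "\<forall>\<^sub>F h in at_right 0. T t (?m h) = S t (?m h)"
    unfolding eventually_at_right_field
    by (intro exI[of _ "1::real"])
      (simp add: Tt.scaleR St.scaleR dom[OF integral_in_generator[OF T]])
  then have "((\<lambda>h. T t (?m h)) \<longlongrightarrow> S t x) (at_right 0)"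
    using St.tendsto[OF m] by (simp add: tendsto_cong)
  then show ?thesis
    using tendsto_unique[OF trivial_limit_at_right_real Tt.tendsto[OF m]] by blast
qed

lemma sg_exp_eq:
  assumes "generates A T" "0 \<le> t"
  shows "sg_exp A t x = T t x"
proof -
  have "generates A (sg_exp A)"
    unfolding sg_exp_def by (rule someI[of "generates A", OF assms(1)])
  then show ?thesis
    using assms by (intro semigroup_unique) (auto simp: generates_def)
qed

subsection \<open>Rescaled semigroups\<close>

lemma C0_semigroup_rescale:
  assumes T: "C0_semigroup T"
  shows "C0_semigroup (\<lambda>t x. exp (of_real t * z) *\<^sub>C T t x)"
  unfolding C0_semigroup_def
proof (intro conjI allI impI)
  fix t :: real assume t: "0 \<le> t"
  have "bounded_linear (\<lambda>x. exp (of_real t * z) *\<^sub>C T t x)"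
    by (rule bounded_linear_compose[OF bounded_bilinear.bounded_linear_right[OF bounded_bilinear_scaleC]
          C0_semigroup_bounded_linear[OF T t]])
  then show "bounded_clinear (\<lambda>x. exp (of_real t * z) *\<^sub>C T t x)"
    by (simp add: bounded_clinear_def C0_semigroup_scaleC[OF T t] scaleC_scaleC mult.commute)
next
  fix s t :: real and x assume "0 \<le> s" "0 \<le> t"
  then show "exp (of_real (s + t) * z) *\<^sub>C T (s + t) x
      = exp (of_real s * z) *\<^sub>C T s (exp (of_real t * z) *\<^sub>C T t x)"
    by (simp add: C0_semigroup_add[OF T] C0_semigroup_scaleC[OF T] scaleC_scaleC exp_add
        ring_distribs)
next
  fix x
  have "((\<lambda>t. exp (of_real t * z) *\<^sub>C T t x) \<longlongrightarrow> exp (of_real 0 * z) *\<^sub>C x) (at_right 0)"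
    by (intro tendsto_scaleC tendsto_intros C0_semigroup_tendsto_0[OF T])
      (auto simp: eventually_at_filter)
  then show "((\<lambda>t. exp (of_real t * z) *\<^sub>C T t x) \<longlongrightarrow> x) (at_right 0)" by simp
qed (simp add: C0_semigroup_0[OF T])

lemma generator_rescale_mem:
  assumes T: "C0_semigroup T" and xy: "(x, y) \<in> generator T"
  shows "(x, z *\<^sub>C x + y) \<in> generator (\<lambda>t x. exp (of_real t * z) *\<^sub>C T t x)"
proof -
  have "((\<lambda>t. exp (of_real t * z)) has_vector_derivative z) (at_right 0)"
    using exp_scaleR_has_vector_derivative_right[of z 0 "{0<..}"]
    by (simp add: scaleR_conv_of_real)
  then have "((\<lambda>t. (1 / t) *\<^sub>R (exp (of_real t * z) - 1)) \<longlongrightarrow> z) (at_right 0)"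
    by (simp add: has_vector_derivative_iff_slope)
  then have "((\<lambda>t. ((1 / t) *\<^sub>R (exp (of_real t * z) - 1)) *\<^sub>C x
      + exp (of_real t * z) *\<^sub>C ((1 / t) *\<^sub>R (T t x - x))) \<longlongrightarrow> z *\<^sub>C x + exp (of_real 0 * z) *\<^sub>C y) (at_right 0)"
    by (intro tendsto_add tendsto_scaleC generatorD[OF xy] tendsto_intros)
  moreover have "((1 / t) *\<^sub>R (exp (of_real t * z) - 1)) *\<^sub>C x
      + exp (of_real t * z) *\<^sub>C ((1 / t) *\<^sub>R (T t x - x))
      = (1 / t) *\<^sub>R (exp (of_real t * z) *\<^sub>C T t x - x)" for t
  proof -
    interpret bounded_bilinear "scaleC :: complex \<Rightarrow> 'a \<Rightarrow> 'a" by (rule bounded_bilinear_scaleC)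
    show ?thesis by (simp add: scaleR_left scaleR_right diff_left diff_right algebra_simps)
  qed
  ultimately show ?thesis by (simp add: generator_def)
qed

text \<open>
  Rescaling by \<open>z\<close> extends the shifted generator; rescaling back by \<open>- z\<close> gives the reverse inclusion.
\<close>

lemma generates_rescale:
  assumes "generates A T"
  shows "generates (scalar_plus z A) (\<lambda>t x. exp (of_real t * z) *\<^sub>C T t x)"
proof -
  let ?S = "\<lambda>t x. exp (of_real t * z) *\<^sub>C T t x"
  have T: "C0_semigroup T" and A: "generator T = A"
    using assms by (auto simp: generates_def)
  have S: "C0_semigroup ?S" by (rule C0_semigroup_rescale[OF T])
  have "generator ?S = scalar_plus z A"
  proof (intro equalityI subsetI)
    fix p assume "p \<in> scalar_plus z A"
    then show "p \<in> generator ?S"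
      using generator_rescale_mem[OF T] by (auto simp: scalar_plus_def A)
  next
    fix p assume p: "p \<in> generator ?S"
    obtain x w where xw: "p = (x, w)" by (cases p)
    have "(x, (- z) *\<^sub>C x + w) \<in> generator (\<lambda>t x. exp (of_real t * (- z)) *\<^sub>C ?S t x)"
      by (rule generator_rescale_mem[OF S p[unfolded xw]])
    also have "(\<lambda>t x. exp (of_real t * (- z)) *\<^sub>C ?S t x) = T"
      by (simp add: scaleC_scaleC exp_add [symmetric])
    finally have "(x, (- z) *\<^sub>C x + w) \<in> A" by (simp add: A)
    moreover have "w = z *\<^sub>C x + ((- z) *\<^sub>C x + w)"
      by (simp add: scaleC_minus_left)
    ultimately show "p \<in> scalar_plus z A"
      unfolding scalar_plus_def xw by blast
  qed
  with S show ?thesis by (simp add: generates_def)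
qed

section \<open>The adjoint semigroup\<close>

lemma op_adjoint_iff: "(y, z) \<in> op_adjoint G \<longleftrightarrow> (\<forall>x w. (x, w) \<in> G \<longrightarrow> cinner w y = cinner x z)"
  by (auto simp: op_adjoint_def)

lemma mem_scalar_plus_iff: "(x, w) \<in> scalar_plus z G \<longleftrightarrow> (x, w - z *\<^sub>C x) \<in> G"
proof
  assume "(x, w - z *\<^sub>C x) \<in> G"
  moreover have "w = z *\<^sub>C x + (w - z *\<^sub>C x)" by simp
  ultimately show "(x, w) \<in> scalar_plus z G"
    unfolding scalar_plus_def by blast
qed (auto simp: scalar_plus_def)

lemma resolvent_setE:
  assumes "z \<in> resolvent_set G"
  obtains R where "bounded_clinear R" "\<And>x w. (x, w) \<in> scalar_plus (- z) G \<longleftrightarrow> x = R w"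
  using assms unfolding resolvent_set_def by blast

lemma resolvent_setI:
  assumes "bounded_clinear R" "\<And>x w. (x, w) \<in> scalar_plus (- z) G \<longleftrightarrow> x = R w"
  shows "z \<in> resolvent_set G"
proof -
  have "scalar_plus (- z) G = {(R y, y) | y. True}"
    using assms(2) by (auto simp del: split_paired_All)
  with assms(1) show ?thesis unfolding resolvent_set_def by blast
qed

lemma resolvent_set_scalar_plus:
  fixes G :: "'a::complex_hilbert operator"
  shows "z \<in> resolvent_set (scalar_plus a G) \<longleftrightarrow> z - a \<in> resolvent_set G"
proof -
  have "w - (- z) *\<^sub>C x - a *\<^sub>C x = w - (- (z - a)) *\<^sub>C x" for x w :: 'a
    using scaleC_add_left[of "- z" a x] by (simp add: algebra_simps)
  then have "scalar_plus (- z) (scalar_plus a G) = scalar_plus (- (z - a)) G"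
    by (auto simp only: mem_scalar_plus_iff)
  then show ?thesis by (simp add: resolvent_set_def)
qed

lemma C0_semigroup_adj_bounded_Icc:
  assumes T: "C0_semigroup T"
  obtains M where "M \<ge> 0" "\<And>t x. 0 \<le> t \<Longrightarrow> t \<le> b \<Longrightarrow> norm (adj (T t) x) \<le> M * norm x"
proof -
  obtain M where M: "M \<ge> 0" "\<And>t x. 0 \<le> t \<Longrightarrow> t \<le> b \<Longrightarrow> norm (T t x) \<le> M * norm x"
    using C0_semigroup_bounded_Icc[OF T, of b] by metis
  have "norm (adj (T t) x) \<le> M * norm x" if "0 \<le> t" "t \<le> b" for t x
    using M(2) that by (intro norm_adj_le C0_semigroup_bounded_clinear[OF T])
  then show ?thesis using that M(1) by blast
qed

text \<open>
  A weak form of \<open>T\<^sup>* t y - y = \<integral>\<^sub>0\<^sup>t T\<^sup>* s w ds\<close> with \<open>w = A\<^sup>* y\<close>, available before the strong continuity of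
  \<open>T\<^sup>*\<close>: the integral is moved to the orbit of \<open>x\<close> under \<open>T\<close>.
\<close>

lemma adj_semigroup_diff:
  assumes T: "C0_semigroup T" and yw: "(y, w) \<in> op_adjoint (generator T)" and t: "0 \<le> t"
  shows "cinner x (adj (T t) y - y) = cinner (integral {0..t} (\<lambda>s. T s x)) w"
proof -
  have "cinner x (adj (T t) y - y) = cinner (T t x - x) y"
    by (simp add: cinner_diff_left cinner_diff_right
        cinner_adj[OF C0_semigroup_bounded_clinear[OF T t]])
  also have "\<dots> = cinner (integral {0..t} (\<lambda>s. T s x)) w"
    using yw integral_in_generator[OF T t, of x] by (simp add: op_adjoint_iff)
  finally show ?thesis .
qed

text \<open>
  The vectors at which the adjoint semigroup is continuous form a closed subspace. It contains the
  domain of the adjoint \<open>A\<^sup>*\<close> of the generator, hence the range of the adjoint of a resolvent of \<open>A\<close>;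
  as the resolvent is injective, nothing is orthogonal to that range.
\<close>

lemma adj_semigroup_tendsto_0:
  assumes T: "C0_semigroup T" and z: "z \<in> resolvent_set (generator T)"
  shows "((\<lambda>t. adj (T t) y) \<longlongrightarrow> y) (at_right 0)"
proof -
  let ?S = "\<lambda>t. adj (T t)"
  let ?M = "{y. ((\<lambda>t. ?S t y) \<longlongrightarrow> y) (at_right 0)}"
  have S: "bounded_clinear (?S t)" if "0 \<le> t" for t
    by (rule bounded_clinear_adj[OF C0_semigroup_bounded_clinear[OF T that]])
  have S': "bounded_linear (?S t)" "?S t (a *\<^sub>C x) = a *\<^sub>C ?S t x" if "0 \<le> t" for t a x
    using S[OF that] by (auto simp: bounded_clinear_def)
  have pos: "\<forall>\<^sub>F t in at_right 0. 0 < t \<and> t < (1::real)"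
    by (simp add: eventually_at_right_field) (metis zero_less_one)
  obtain K where K: "K \<ge> 0" "\<And>t x. 0 \<le> t \<Longrightarrow> t \<le> 1 \<Longrightarrow> norm (T t x) \<le> K * norm x"
    using C0_semigroup_bounded_Icc[OF T, of 1] by metis
  obtain L where L: "L \<ge> 0" "\<And>t x. 0 \<le> t \<Longrightarrow> t \<le> 1 \<Longrightarrow> norm (?S t x) \<le> L * norm x"
    using C0_semigroup_adj_bounded_Icc[OF T, of 1] by metis
  have dom: "y \<in> ?M" if yw: "(y, w) \<in> op_adjoint (generator T)" for y w
  proof -
    have le: "norm (?S t y - y) \<le> t * (K * norm w)" if t: "0 < t" "t < 1" for t
    proof (cases "?S t y - y = 0")
      case True
      then show ?thesis using t K by simp
    next
      case False
      define v where "v = ?S t y - y"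
      have "cinner (integral {0..t} (\<lambda>s. T s v)) w = complex_of_real ((norm v)\<^sup>2)"
        using adj_semigroup_diff[OF T yw, of t v] t by (simp add: v_def [symmetric] cinner_self)
      then have "(norm v)\<^sup>2 = cmod (cinner (integral {0..t} (\<lambda>s. T s v)) w)"
        by (simp add: norm_power)
      also have "\<dots> \<le> norm (integral {0..t} (\<lambda>s. T s v)) * norm w"
        by (rule norm_cinner_le)
      also have "norm (integral {0..t} (\<lambda>s. T s v)) \<le> integral {0..t} (\<lambda>s. K * norm v)"
        using t by (intro integral_norm_bound_integral C0_semigroup_integrable[OF T] K(2)) auto
      finally have "norm v * norm v \<le> norm v * (t * (K * norm w))"
        using t by (simp add: power2_eq_square mult_right_mono mult_ac)
      then show ?thesis
        using False by (simp add: v_def)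
    qed
    have "((\<lambda>t. t * (K * norm w)) \<longlongrightarrow> 0 * (K * norm w)) (at_right 0)"
      by (intro tendsto_intros)
    then have lim: "((\<lambda>t. t * (K * norm w)) \<longlongrightarrow> 0) (at_right 0)" by simp
    have "\<forall>\<^sub>F t in at_right 0. norm (?S t y - y) \<le> t * (K * norm w)"
      using pos by eventually_elim (use le in auto)
    from Lim_null_comparison[OF this lim] show ?thesis
      by (simp add: LIM_zero_iff)
  qed
  have closed: "closed ?M"
    unfolding closure_subset_eq [symmetric]
  proof
    fix y assume y: "y \<in> closure ?M"
    have "((\<lambda>t. ?S t y) \<longlongrightarrow> y) (at_right 0)"
    proof (rule tendstoI)
      fix e :: real assume e: "e > 0"
      have "e / (2 * (L + 1)) > 0" using e L by simp
      then obtain y' where y': "((\<lambda>t. ?S t y') \<longlongrightarrow> y') (at_right 0)" "dist y' y < e / (2 * (L + 1))"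
        using y unfolding closure_approachable by blast
      have near: "(L + 1) * norm (y - y') < e / 2"
        using y'(2) L by (simp add: dist_norm norm_minus_commute field_simps)
      show "\<forall>\<^sub>F t in at_right 0. dist (?S t y) y < e"
        using tendstoD[OF y'(1) half_gt_zero[OF e]] pos
      proof eventually_elim
        case (elim t)
        interpret bounded_linear "?S t" using elim by (intro S') auto
        have "?S t y - y = ?S t (y - y') + (?S t y' - y') - (y - y')"
          by (simp add: diff)
        then have "norm (?S t y - y) \<le> norm (?S t (y - y')) + norm (?S t y' - y') + norm (y - y')"
          using norm_triangle_ineq4[of "?S t (y - y') + (?S t y' - y')" "y - y'"]
            norm_triangle_ineq[of "?S t (y - y')" "?S t y' - y'"] by simp
        also have "norm (?S t (y - y')) \<le> L * norm (y - y')"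
          using elim by (intro L) auto
        finally show ?case
          using elim near by (simp add: dist_norm algebra_simps)
      qed
    qed
    then show "y \<in> ?M" by simp
  qed
  have zero: "0 \<in> ?M"
  proof -
    have "\<forall>\<^sub>F t in at_right 0. ?S t 0 = 0"
      using pos by eventually_elim (use S'(1) in \<open>auto simp: linear_simps\<close>)
    then show ?thesis by (simp add: tendsto_eventually)
  qed
  have add: "x + y \<in> ?M" if "x \<in> ?M" "y \<in> ?M" for x y
  proof -
    have "((\<lambda>t. ?S t x + ?S t y) \<longlongrightarrow> x + y) (at_right 0)"
      using that by (intro tendsto_add) auto
    moreover have "\<forall>\<^sub>F t in at_right 0. ?S t x + ?S t y = ?S t (x + y)"
      using pos by eventually_elim (use S'(1) in \<open>auto simp: linear_simps\<close>)
    ultimately have "((\<lambda>t. ?S t (x + y)) \<longlongrightarrow> x + y) (at_right 0)"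
      by (rule Lim_transform_eventually)
    then show ?thesis by simp
  qed
  have scale: "a *\<^sub>C x \<in> ?M" if "x \<in> ?M" for a x
  proof -
    have "((\<lambda>t. a *\<^sub>C ?S t x) \<longlongrightarrow> a *\<^sub>C x) (at_right 0)"
      using that by (intro tendsto_scaleC) auto
    moreover have "\<forall>\<^sub>F t in at_right 0. a *\<^sub>C ?S t x = ?S t (a *\<^sub>C x)"
      using pos by eventually_elim (use S'(2) in auto)
    ultimately have "((\<lambda>t. ?S t (a *\<^sub>C x)) \<longlongrightarrow> a *\<^sub>C x) (at_right 0)"
      by (rule Lim_transform_eventually)
    then show ?thesis by simp
  qed
  have M: "y \<in> ?M" if total: "\<And>v. (\<And>m. m \<in> ?M \<Longrightarrow> cinner m v = 0) \<Longrightarrow> v = 0" for y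
  proof (rule ccontr)
    assume "y \<notin> ?M"
    show False
    proof (rule orthogonal_vector_exists[OF closed zero add scale \<open>y \<notin> ?M\<close>])
      fix v assume v: "v \<noteq> 0" "\<And>m. m \<in> ?M \<Longrightarrow> cinner m v = 0"
      have "v = 0" by (rule total) (rule v(2))
      with v(1) show False ..
    qed
  qed
  obtain R where R: "bounded_clinear R"
    "\<And>x w. (x, w) \<in> scalar_plus (- z) (generator T) \<longleftrightarrow> x = R w"
    using resolvent_setE[OF z] by blast
  have gen_iff: "(x, w) \<in> generator T \<longleftrightarrow> x = R (w - z *\<^sub>C x)" for x w
    using R(2)[of x "w - z *\<^sub>C x"] by (simp add: mem_scalar_plus_iff scaleC_minus_left)
  have "adj R u \<in> ?M" for u
  proof (rule dom)
    \<comment> \<open>Taking adjoints in \<open>R (A - z) = Id\<close> gives \<open>A\<^sup>* (R\<^sup>* u) = u + cnj z R\<^sup>* u\<close>.\<close>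
    show "(adj R u, u + cnj z *\<^sub>C adj R u) \<in> op_adjoint (generator T)"
      unfolding op_adjoint_iff
    proof (intro allI impI)
      fix x w assume "(x, w) \<in> generator T"
      then have x: "R (w - z *\<^sub>C x) = x" by (simp add: gen_iff)
      have "cinner (w - z *\<^sub>C x) (adj R u) = cinner x u"
        using cinner_adj[OF R(1), of "w - z *\<^sub>C x" u] x by simp
      then show "cinner w (adj R u) = cinner x (u + cnj z *\<^sub>C adj R u)"
        by (simp add: cinner_diff_left cinner_add_right cinner_scaleC_left cinner_scaleC_right
            algebra_simps)
    qed
  qed
  moreover have "v = 0" if "\<And>u. cinner (adj R u) v = 0" for v
  proof -
    have "cinner x (R v) = 0" for x
      using that[of x] cinner_adj[OF R(1), of v x] by (metis cinner_commute complex_cnj_zero)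
    then have "R v = 0" using cinner_eqI[of "R v" 0] by simp
    then have "(0, v) \<in> generator T" by (simp add: gen_iff)
    moreover have "T t 0 = 0" if "0 < t" for t
      using C0_semigroup_bounded_linear[OF T, of t] that by (simp add: linear_simps)
    then have "\<forall>\<^sub>F t in at_right 0. (1 / t) *\<^sub>R (T t 0 - 0) = 0"
      using pos by (auto elim: eventually_mono)
    then have "((\<lambda>t. (1 / t) *\<^sub>R (T t 0 - 0)) \<longlongrightarrow> 0) (at_right 0)"
      by (rule tendsto_eventually)
    ultimately show ?thesis
      using tendsto_unique[OF trivial_limit_at_right_real] generatorD by blast
  qed
  ultimately have "y \<in> ?M" by (intro M) blast
  then show ?thesis by simp
qed

lemma C0_semigroup_adj:
  assumes T: "C0_semigroup T" and z: "z \<in> resolvent_set (generator T)"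
  shows "C0_semigroup (\<lambda>t. adj (T t))"
  unfolding C0_semigroup_def
proof (intro conjI allI impI)
  show "adj (T 0) x = x" for x
    by (rule cinner_eqI)
      (simp add: cinner_adj[OF C0_semigroup_bounded_clinear[OF T], symmetric] C0_semigroup_0[OF T])
  show "adj (T (s + t)) x = adj (T s) (adj (T t) x)" if "0 \<le> s" "0 \<le> t" for s t x
  proof (rule cinner_eqI)
    fix v
    have "T (s + t) v = T t (T s v)"
      using C0_semigroup_add[OF T that(2,1), of v] by (simp add: add.commute)
    then show "cinner v (adj (T (s + t)) x) = cinner v (adj (T s) (adj (T t) x))"
      using that by (simp add: cinner_adj[OF C0_semigroup_bounded_clinear[OF T], symmetric])
  qed
qed (use adj_semigroup_tendsto_0[OF T z] bounded_clinear_adj C0_semigroup_bounded_clinear[OF T] in auto)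

text \<open>
  Difference quotients of \<open>T\<^sup>*\<close> pass to those of \<open>T\<close> under the inner product, so the generator of \<open>T\<^sup>*\<close> is
  contained in \<open>A\<^sup>*\<close>. Conversely \<open>T\<^sup>* t y - y = \<integral>\<^sub>0\<^sup>t T\<^sup>* s (A\<^sup>* y) ds\<close> can be differentiated at \<open>0\<close>.
\<close>

lemma generates_adj:
  assumes "generates A T" and z: "z \<in> resolvent_set A"
  shows "generates (op_adjoint A) (\<lambda>t. adj (T t))"
proof -
  let ?S = "\<lambda>t. adj (T t)"
  have T: "C0_semigroup T" and A: "generator T = A"
    using assms by (auto simp: generates_def)
  have S: "C0_semigroup ?S" using C0_semigroup_adj[OF T] z A by simp
  have adj: "cinner (T t x) y = cinner x (?S t y)" if "0 \<le> t" for t x y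
    by (rule cinner_adj[OF C0_semigroup_bounded_clinear[OF T that]])
  have "p \<in> op_adjoint A" if "p \<in> generator ?S" for p
  proof -
    obtain y z where p: "p = (y, z)" by (cases p)
    have "cinner w y = cinner x z" if "(x, w) \<in> generator T" for x w
    proof -
      have "((\<lambda>t. cinner ((1 / t) *\<^sub>R (T t x - x)) y) \<longlongrightarrow> cinner w y) (at_right 0)"
        by (intro tendsto_cinner generatorD[OF that] tendsto_const)
      moreover have "\<forall>\<^sub>F t in at_right 0.
          cinner ((1 / t) *\<^sub>R (T t x - x)) y = cinner x ((1 / t) *\<^sub>R (?S t y - y))"
        unfolding eventually_at_right_field
        by (intro exI[of _ "1::real"])
          (simp add: cinner_scaleR_left cinner_scaleR_right cinner_diff_left cinner_diff_right adj)
      ultimately have "((\<lambda>t. cinner x ((1 / t) *\<^sub>R (?S t y - y))) \<longlongrightarrow> cinner w y) (at_right 0)"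
        by (rule Lim_transform_eventually)
      moreover have "((\<lambda>t. cinner x ((1 / t) *\<^sub>R (?S t y - y))) \<longlongrightarrow> cinner x z) (at_right 0)"
        using \<open>p \<in> generator ?S\<close> p by (intro tendsto_cinner tendsto_const generatorD) simp
      ultimately show ?thesis
        using tendsto_unique[OF trivial_limit_at_right_real] by blast
    qed
    then show ?thesis by (simp add: p op_adjoint_iff A)
  qed
  moreover have "(y, w) \<in> generator ?S" if yw: "(y, w) \<in> op_adjoint A" for y w
  proof -
    have eq: "?S t y - y = integral {0..t} (\<lambda>s. ?S s w)" if t: "0 \<le> t" for t
    proof (rule cinner_eqI)
      fix x
      have "cinner x (?S t y - y) = cinner (integral {0..t} (\<lambda>s. T s x)) w"
        using adj_semigroup_diff[OF T _ t] yw A by simp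
      also have "\<dots> = integral {0..t} ((\<lambda>v. cinner v w) \<circ> (\<lambda>s. T s x))"
        by (intro integral_linear[symmetric] C0_semigroup_integrable[OF T] bounded_linear_cinner_left)
          simp
      also have "\<dots> = integral {0..t} (cinner x \<circ> (\<lambda>s. ?S s w))"
        by (intro integral_cong) (simp add: adj)
      also have "\<dots> = cinner x (integral {0..t} (\<lambda>s. ?S s w))"
        by (intro integral_linear C0_semigroup_integrable[OF S] bounded_linear_cinner_right) simp
      finally show "cinner x (?S t y - y) = cinner x (integral {0..t} (\<lambda>s. ?S s w))" .
    qed
    have "((\<lambda>h. (1 / h) *\<^sub>R integral {0..0 + h} (\<lambda>s. ?S s w)) \<longlongrightarrow> ?S 0 w) (at_right 0)"
      by (rule C0_semigroup_integral_mean[OF S]) simp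
    moreover have "\<forall>\<^sub>F h in at_right 0. (1 / h) *\<^sub>R integral {0..0 + h} (\<lambda>s. ?S s w)
        = (1 / h) *\<^sub>R (?S h y - y)"
      unfolding eventually_at_right_field by (intro exI[of _ "1::real"]) (simp add: eq)
    ultimately have "((\<lambda>h. (1 / h) *\<^sub>R (?S h y - y)) \<longlongrightarrow> ?S 0 w) (at_right 0)"
      by (rule Lim_transform_eventually)
    then show ?thesis
      by (simp add: generator_def C0_semigroup_0[OF S])
  qed
  ultimately have "generator ?S = op_adjoint A" by auto
  with S show ?thesis by (simp add: generates_def)
qed

section \<open>The covariance operator\<close>

subsection \<open>The covariance of the noise is bounded\<close>

lemma single_valued_op_adjoint:
  assumes "densely_defined B"
  shows "single_valued (op_adjoint B)"
proof (rule single_valuedI)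
  fix y z z' assume z: "(y, z) \<in> op_adjoint B" and z': "(y, z') \<in> op_adjoint B"
  let ?C = "{x. cinner x z = cinner x z'}"
  have "closed ?C"
    by (intro closed_Collect_eq linear_continuous_on bounded_linear_cinner_left)
  moreover have "Domain B \<subseteq> ?C"
    using z z' by (force simp: op_adjoint_iff)
  ultimately have "closure (Domain B) \<subseteq> ?C"
    by (rule closure_minimal[rotated])
  then show "z = z'"
    using assms by - (rule cinner_eqI, auto simp: densely_defined_def)
qed

lemma noise_cov_symmetric:
  assumes Q: "self_adjoint Q" and x: "(x, v) \<in> noise_cov B Q" and y: "(y, w) \<in> noise_cov B Q"
  shows "cinner v y = cinner x w"
proof -
  obtain a b where ab: "(x, a) \<in> op_adjoint B" "(a, b) \<in> Q" "(b, v) \<in> B"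
    using x by (auto simp: noise_cov_def)
  obtain a' b' where ab': "(y, a') \<in> op_adjoint B" "(a', b') \<in> Q" "(b', w) \<in> B"
    using y by (auto simp: noise_cov_def)
  have "op_adjoint Q = Q" using Q by (simp add: self_adjoint_def)
  with ab'(2) have a'b': "(a', b') \<in> op_adjoint Q" by blast
  have "cinner v y = cinner b a'" using ab ab' by (simp add: op_adjoint_iff)
  also have "\<dots> = cinner a b'"
    using ab(2) a'b' by (simp add: op_adjoint_iff)
  also have "\<dots> = cnj (cinner b' a)" by (rule cinner_commute)
  also have "cinner b' a = cinner w x" using ab ab' by (simp add: op_adjoint_iff)
  also have "cnj \<dots> = cinner x w" by (rule cinner_commute [symmetric])
  finally show ?thesis .
qed

text \<open>
  The lower bound forces the covariance of the noise to be everywhere defined. It is then bounded by the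
  Hellinger-Toeplitz theorem, even if \<open>B\<close> and \<open>Q\<close> are not.
\<close>

lemma noise_cov_bounded:
  assumes B: "linear_operator B" "densely_defined B" and Q: "self_adjoint Q"
    and below: "bounded_below_by (noise_cov B Q) c"
  shows "bounded_linear (op_apply (noise_cov B Q))"
    and "c * (norm h)\<^sup>2 \<le> Re (cinner (op_apply (noise_cov B Q) h) h)"
proof -
  let ?N = "op_apply (noise_cov B Q)"
  have "single_valued (noise_cov B Q)"
    unfolding noise_cov_def using B Q
    by (intro single_valued_relcomp single_valued_op_adjoint)
      (auto simp: linear_operator_def self_adjoint_def)
  then have eq: "?N x = y" if "(x, y) \<in> noise_cov B Q" for x y
    unfolding op_apply_def using that by (auto dest: single_valuedD)
  have mem: "(x, ?N x) \<in> noise_cov B Q" for x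
    using below eq unfolding bounded_below_by_def by metis
  show "bounded_linear ?N"
    by (rule symmetric_bounded_linear) (rule noise_cov_symmetric[OF Q mem mem])
  show "c * (norm h)\<^sup>2 \<le> Re (cinner (?N h) h)"
    using below eq unfolding bounded_below_by_def by metis
qed

subsection \<open>Convergence of the covariance operators\<close>

lemma integral_exp_le:
  fixes a :: real
  assumes "a > 0" "s \<le> t"
  shows "integral {s..t} (\<lambda>\<tau>. exp (- a * \<tau>)) \<le> exp (- a * s) / a"
proof -
  have "((\<lambda>\<tau>. exp (- a * \<tau>)) has_integral (- exp (- a * t) / a - (- exp (- a * s) / a))) {s..t}"
    using assms
    by (intro fundamental_theorem_of_calculus)
      (auto intro!: derivative_eq_intros simp flip: has_real_derivative_iff_has_vector_derivative)
  then have "integral {s..t} (\<lambda>\<tau>. exp (- a * \<tau>)) = - exp (- a * t) / a - (- exp (- a * s) / a)"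
    by (rule integral_unique)
  also have "\<dots> \<le> exp (- a * s) / a"
    using assms by simp
  finally show ?thesis .
qed

lemma exp_bounded_integral_converges:
  fixes F :: "real \<Rightarrow> 'a::banach"
  assumes cont: "continuous_on {0..} F" and a: "a > 0"
    and le: "\<And>\<tau>. 0 \<le> \<tau> \<Longrightarrow> norm (F \<tau>) \<le> C * exp (- a * \<tau>)"
  obtains L where "((\<lambda>t. integral {0..t} F) \<longlongrightarrow> L) at_top"
proof -
  let ?I = "\<lambda>t. integral {0..t} F"
  have int: "F integrable_on {s..t}" if "0 \<le> s" for s t
    using that by (intro integrable_continuous_real continuous_on_subset[OF cont]) auto
  have "0 \<le> C"
    using le[of 0] by (simp add: order_trans[OF norm_ge_zero])
  have dist: "norm (?I t - ?I s) \<le> (C / a) * exp (- a * s)" if st: "0 \<le> s" "s \<le> t" for s t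
  proof -
    have "?I s + integral {s..t} F = ?I t"
      using st by (intro Henstock_Kurzweil_Integration.integral_combine int) auto
    then have "norm (?I t - ?I s) = norm (integral {s..t} F)"
      by (metis add_diff_cancel_left')
    also have "\<dots> \<le> integral {s..t} (\<lambda>\<tau>. C * exp (- a * \<tau>))"
      using st by (intro integral_norm_bound_integral int le integrable_continuous_real continuous_intros) auto
    also have "\<dots> \<le> C * (exp (- a * s) / a)"
      unfolding integral_mult_right
      by (rule mult_left_mono[OF integral_exp_le[OF a st(2)] \<open>0 \<le> C\<close>])
    finally show ?thesis by simp
  qed
  have lim0: "((\<lambda>s. (C / a) * exp (- a * s)) \<longlongrightarrow> 0) at_top"
  proof -
    have "filterlim (\<lambda>s. - a * s) at_bot at_top"
      using a by (intro filterlim_tendsto_neg_mult_at_bot[OF tendsto_const] filterlim_ident) auto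
    from tendsto_mult_left[OF filterlim_compose[OF exp_at_bot this], of "C / a"]
    show ?thesis by simp
  qed
  have "Cauchy (\<lambda>n. ?I (real n))"
  proof (rule metric_CauchyI)
    fix e :: real assume e: "e > 0"
    have "(\<lambda>n. (C / a) * exp (- a * real n)) \<longlonglongrightarrow> 0"
      by (rule filterlim_compose[OF lim0 filterlim_real_sequentially])
    from order_tendstoD(2)[OF this e] obtain n0 where n0: "\<And>n. n \<ge> n0 \<Longrightarrow> (C / a) * exp (- a * real n) < e"
      by (auto simp: eventually_sequentially)
    have "dist (?I (real i)) (?I (real j)) < e" if "i \<ge> n0" "j \<ge> n0" for i j
    proof (cases "i \<le> j")
      case True
      have "norm (?I (real j) - ?I (real i)) < e"
        using dist[of "real i" "real j"] n0[OF that(1)] True by simp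
      then show ?thesis by (simp add: dist_norm norm_minus_commute)
    next
      case False
      then show ?thesis
        using dist[of "real j" "real i"] n0[OF that(2)] by (simp add: dist_norm)
    qed
    then show "\<exists>n0. \<forall>i\<ge>n0. \<forall>j\<ge>n0. dist (?I (real i)) (?I (real j)) < e" by blast
  qed
  then obtain L where L: "(\<lambda>n. ?I (real n)) \<longlonglongrightarrow> L"
    using Cauchy_convergent convergent_def by blast
  have "norm (?I s - L) \<le> (C / a) * exp (- a * s)" if s: "0 \<le> s" for s
  proof (rule tendsto_upperbound)
    show "(\<lambda>n. norm (?I s - ?I (real n))) \<longlonglongrightarrow> norm (?I s - L)"
      by (intro tendsto_intros L)
    show "\<forall>\<^sub>F n in sequentially. norm (?I s - ?I (real n)) \<le> (C / a) * exp (- a * s)"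
      using eventually_ge_at_top[of "nat \<lceil>s\<rceil>"]
    proof eventually_elim
      case (elim n)
      then have "s \<le> real n" by linarith
      from dist[OF s this] show ?case by (subst norm_minus_commute)
    qed
  qed simp
  then have "\<forall>\<^sub>F s in at_top. norm (?I s - L) \<le> (C / a) * exp (- a * s)"
    by (rule eventually_mono[OF eventually_ge_at_top[of 0]])
  from Lim_null_comparison[OF this lim0] have "(?I \<longlongrightarrow> L) at_top"
    by (simp add: LIM_zero_iff)
  then show ?thesis by (rule that)
qed

text \<open>
  Exponential decay of \<open>T\<close>, hence of \<open>T\<^sup>*\<close>, makes the covariance operators converge. Their quadratic
  forms are integrals of \<open>\<langle>N (T\<^sup>* s h), T\<^sup>* s h\<rangle> \<ge> c \<parallel>T\<^sup>* s h\<parallel>\<^sup>2\<close>, which can only grow with the upper limit.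
\<close>

lemma cov_inf_lower_bound:
  assumes gen: "generates A T" and z: "z \<in> resolvent_set A"
    and a: "a > 0" and stable: "\<And>t x. 0 \<le> t \<Longrightarrow> norm (T t x) \<le> M * exp (- a * t) * norm x"
    and N: "bounded_linear (op_apply (noise_cov B Q))"
    and c: "c \<ge> 0" "\<And>h. c * (norm h)\<^sup>2 \<le> Re (cinner (op_apply (noise_cov B Q) h) h)"
    and t: "0 \<le> t"
  shows "\<sigma>\<^sup>2 * (c * integral {0..t} (\<lambda>s. (norm (adj (T s) h))\<^sup>2)) \<le> Re (cinner (cov_inf \<sigma> A B Q h) h)"
proof -
  let ?N = "op_apply (noise_cov B Q)" and ?S = "\<lambda>t. adj (T t)"
  define F where "F = (\<lambda>\<tau>. T \<tau> (?N (?S \<tau> h)))"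
  have T: "C0_semigroup T" using gen by (simp add: generates_def)
  have genS: "generates (op_adjoint A) ?S" by (rule generates_adj[OF gen z])
  then have S: "C0_semigroup ?S" by (simp add: generates_def)
  have contS: "continuous_on {0..} (\<lambda>\<tau>. ?S \<tau> h)"
    by (rule C0_semigroup_continuous_on[OF S continuous_on_const]) simp
  have cont: "continuous_on {0..} F"
    unfolding F_def
    by (rule C0_semigroup_continuous_on[OF T bounded_linear.continuous_on[OF N contS]]) simp
  have int: "F integrable_on {0..s}" for s
    by (intro integrable_continuous_real continuous_on_subset[OF cont]) auto
  have intS: "(\<lambda>s. (norm (?S s h))\<^sup>2) integrable_on {r..s}" if "0 \<le> r" for r s
    using that by (intro integrable_continuous_real continuous_intros continuous_on_subset[OF contS]) auto
  have cov: "cov \<sigma> A B Q s h = \<sigma>\<^sup>2 *\<^sub>R integral {0..s} F" for s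
    unfolding cov_def F_def
    by (intro arg_cong[where f = "(*\<^sub>R) (\<sigma>\<^sup>2)"] integral_cong)
      (simp add: sg_exp_eq[OF gen] sg_exp_eq[OF genS])
  obtain K where K: "K \<ge> 0" "\<And>x. norm (?N x) \<le> norm x * K"
    using bounded_linear.nonneg_bounded[OF N] by blast
  have stable': "norm (T t x) \<le> \<bar>M\<bar> * exp (- a * t) * norm x" if "0 \<le> t" for t x
    using stable[OF that, of x] by (rule order_trans) (simp add: mult_right_mono)
  have "norm (F \<tau>) \<le> (\<bar>M\<bar> * K * \<bar>M\<bar> * norm h) * exp (- (2 * a) * \<tau>)" if \<tau>: "0 \<le> \<tau>" for \<tau>
  proof -
    have "norm (F \<tau>) \<le> (\<bar>M\<bar> * exp (- a * \<tau>)) * norm (?N (?S \<tau> h))"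
      unfolding F_def by (rule stable'[OF \<tau>])
    also have "norm (?N (?S \<tau> h)) \<le> norm (?S \<tau> h) * K" by (rule K)
    also have "norm (?S \<tau> h) \<le> (\<bar>M\<bar> * exp (- a * \<tau>)) * norm h"
      by (rule norm_adj_le[OF C0_semigroup_bounded_clinear[OF T \<tau>] stable'[OF \<tau>]])
    finally have "norm (F \<tau>) \<le> (\<bar>M\<bar> * exp (- a * \<tau>)) * (((\<bar>M\<bar> * exp (- a * \<tau>)) * norm h) * K)"
      using K by (simp add: mult_left_mono mult_right_mono)
    also have "\<dots> = (\<bar>M\<bar> * K * \<bar>M\<bar> * norm h) * (exp (- a * \<tau>) * exp (- a * \<tau>))"
      by (simp add: mult_ac)
    also have "exp (- a * \<tau>) * exp (- a * \<tau>) = exp (- (2 * a) * \<tau>)"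
      by (simp flip: exp_add)
    finally show ?thesis .
  qed
  then obtain L where "((\<lambda>t. integral {0..t} F) \<longlongrightarrow> L) at_top"
    using exp_bounded_integral_converges[OF cont, of "2 * a"] a by auto
  then have lim: "((\<lambda>t. cov \<sigma> A B Q t h) \<longlongrightarrow> \<sigma>\<^sup>2 *\<^sub>R L) at_top"
    unfolding cov by (intro tendsto_intros)
  then have "cov_inf \<sigma> A B Q h = \<sigma>\<^sup>2 *\<^sub>R L"
    unfolding cov_inf_def by (intro tendsto_Lim) auto
  then have lim: "((\<lambda>t. Re (cinner (cov \<sigma> A B Q t h) h)) \<longlongrightarrow> Re (cinner (cov_inf \<sigma> A B Q h) h)) at_top"
    using lim by (intro tendsto_Re tendsto_cinner tendsto_const) simp
  have "\<sigma>\<^sup>2 * (c * integral {0..t} (\<lambda>s. (norm (?S s h))\<^sup>2)) \<le> Re (cinner (cov \<sigma> A B Q r h) h)"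
    if r: "t \<le> r" for r
  proof -
    have "integral {0..t} (\<lambda>s. (norm (?S s h))\<^sup>2) \<le> integral {0..r} (\<lambda>s. (norm (?S s h))\<^sup>2)"
      using r by (intro integral_subset_le intS) auto
    then have "c * integral {0..t} (\<lambda>s. (norm (?S s h))\<^sup>2) \<le> integral {0..r} (\<lambda>s. c * (norm (?S s h))\<^sup>2)"
      using c by (simp add: mult_left_mono)
    also have "\<dots> \<le> integral {0..r} ((\<lambda>v. Re (cinner v h)) \<circ> F)"
    proof (rule integral_le)
      show "(\<lambda>s. c * (norm (?S s h))\<^sup>2) integrable_on {0..r}"
        by (intro integrable_continuous_real continuous_intros continuous_on_subset[OF contS]) auto
      show "(\<lambda>v. Re (cinner v h)) \<circ> F integrable_on {0..r}"
        by (intro integrable_linear int bounded_linear_compose[OF bounded_linear_Re] bounded_linear_cinner_left)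
      fix s assume "s \<in> {0..r}"
      then have "cinner (F s) h = cinner (?N (?S s h)) (?S s h)"
        unfolding F_def by (intro cinner_adj C0_semigroup_bounded_clinear[OF T]) auto
      then show "c * (norm (?S s h))\<^sup>2 \<le> ((\<lambda>v. Re (cinner v h)) \<circ> F) s"
        using c(2)[of "?S s h"] by simp
    qed
    also have "\<dots> = Re (cinner (integral {0..r} F) h)"
      by (intro integral_linear int bounded_linear_compose[OF bounded_linear_Re] bounded_linear_cinner_left)
    finally show ?thesis
      by (simp add: cov cinner_scaleR_left mult_left_mono)
  qed
  then show ?thesis
    by (intro tendsto_lowerbound[OF lim] eventually_mono[OF eventually_ge_at_top[of t]]) simp_all
qed

section \<open>Square integrable orbits and the resolvent\<close>

text \<open>
  The resolvent at \<open>\<mu>\<close> is a Laplace transform, \<open>\<langle>x, u\<rangle> = - \<integral>\<^sub>0\<^sup>\<infinity> e\<^sup>-\<^sup>\<mu>\<^sup>s \<langle>y, T\<^sup>* s u\<rangle> ds\<close> for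
  \<open>y = (A - \<mu>) x\<close>. With \<open>\<epsilon> = Re \<mu>\<close>, the estimate is the Cauchy-Schwarz inequality for \<open>e\<^sup>-\<^sup>\<epsilon>\<^sup>s\<close> and
  \<open>\<parallel>T\<^sup>* s u\<parallel>\<close>, obtained from the pointwise inequality \<open>a b \<le> (\<surd>\<epsilon> a\<^sup>2 + b\<^sup>2 / \<surd>\<epsilon>) / 2\<close>.
\<close>

lemma resolvent_weak_bound:
  assumes gen: "generates A T" and z: "z \<in> resolvent_set A"
    and growth: "\<And>t x. 0 \<le> t \<Longrightarrow> norm (T t x) \<le> M * exp (\<delta> * t) * norm x"
    and \<delta>: "\<delta> < Re \<mu>" and pos: "0 < Re \<mu>"
    and K: "\<And>t. 0 \<le> t \<Longrightarrow> integral {0..t} (\<lambda>s. (norm (adj (T s) u))\<^sup>2) \<le> K"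
    and xy: "(x, y) \<in> scalar_plus (- \<mu>) A"
  shows "cmod (cinner x u) \<le> (1 / 4 + K / 2) / sqrt (Re \<mu>) * norm y"
proof -
  let ?\<epsilon> = "Re \<mu>" and ?S = "\<lambda>t. adj (T t)"
  define E where "E = (\<lambda>t x. exp (of_real t * (- \<mu>)) *\<^sub>C T t x)"
  have T: "C0_semigroup T" using gen by (simp add: generates_def)
  have "generates (scalar_plus (- \<mu>) A) E"
    unfolding E_def by (rule generates_rescale[OF gen])
  then have E: "C0_semigroup E" and genE: "generator E = scalar_plus (- \<mu>) A"
    by (auto simp: generates_def)
  have S: "C0_semigroup ?S"
    using generates_adj[OF gen z] by (simp add: generates_def)
  have contS: "continuous_on {0..} (\<lambda>s. ?S s u)"
    by (rule C0_semigroup_continuous_on[OF S continuous_on_const]) simp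
  have normE: "norm (E t x) = exp (- ?\<epsilon> * t) * norm (T t x)" for t x
    by (simp add: E_def norm_scaleC norm_exp_eq_Re mult.commute)
  have bound: "cmod (cinner (E t x - x) u) \<le> (1 / 4 + K / 2) / sqrt ?\<epsilon> * norm y" if t: "0 \<le> t" for t
  proof -
    have "cinner (E t x - x) u = cinner (integral {0..t} (\<lambda>s. E s y)) u"
      using integral_generator[OF E _ t, of x y] xy genE by simp
    also have "\<dots> = integral {0..t} ((\<lambda>v. cinner v u) \<circ> (\<lambda>s. E s y))"
      by (intro integral_linear[symmetric] C0_semigroup_integrable[OF E] bounded_linear_cinner_left) simp
    also have "cmod \<dots> \<le> integral {0..t} (\<lambda>s. norm y *
        (sqrt ?\<epsilon> / 2 * exp (- (2 * ?\<epsilon>) * s) + 1 / (2 * sqrt ?\<epsilon>) * (norm (?S s u))\<^sup>2))"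
    proof (rule integral_norm_bound_integral)
      show "(\<lambda>v. cinner v u) \<circ> (\<lambda>s. E s y) integrable_on {0..t}"
        by (intro integrable_linear C0_semigroup_integrable[OF E] bounded_linear_cinner_left) simp
      show "(\<lambda>s. norm y * (sqrt ?\<epsilon> / 2 * exp (- (2 * ?\<epsilon>) * s) + 1 / (2 * sqrt ?\<epsilon>) * (norm (?S s u))\<^sup>2))
          integrable_on {0..t}"
        by (intro integrable_continuous_real continuous_intros continuous_on_subset[OF contS]) auto
      fix s assume s: "s \<in> {0..t}"
      have "cinner (E s y) u = exp (of_real s * (- \<mu>)) * cinner y (?S s u)"
        using s by (simp add: E_def cinner_scaleC_left cinner_adj[OF C0_semigroup_bounded_clinear[OF T]])
      then have "cmod (cinner (E s y) u) = exp (- ?\<epsilon> * s) * cmod (cinner y (?S s u))"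
        by (simp add: norm_mult norm_exp_eq_Re mult.commute)
      also have "\<dots> \<le> exp (- ?\<epsilon> * s) * (norm y * norm (?S s u))"
        by (intro mult_left_mono norm_cinner_le) simp
      also have "\<dots> = norm y * (exp (- ?\<epsilon> * s) * norm (?S s u))"
        by (simp add: mult_ac)
      also have "\<dots> \<le> norm y * (sqrt ?\<epsilon> / 2 * exp (- (2 * ?\<epsilon>) * s) + 1 / (2 * sqrt ?\<epsilon>) * (norm (?S s u))\<^sup>2)"
      proof (intro mult_left_mono)
        have young: "p * q \<le> r / 2 * p\<^sup>2 + 1 / (2 * r) * q\<^sup>2" if "r > 0" for p q r :: real
        proof -
          have "0 \<le> (r * p - q)\<^sup>2 / (2 * r)" using that by simp
          also have "\<dots> = r / 2 * p\<^sup>2 + 1 / (2 * r) * q\<^sup>2 - p * q"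
            using that by (simp add: power2_eq_square field_simps)
          finally show ?thesis by simp
        qed
        have "(exp (- ?\<epsilon> * s))\<^sup>2 = exp (- (2 * ?\<epsilon>) * s)"
          by (simp add: power2_eq_square flip: exp_add)
        then show "exp (- ?\<epsilon> * s) * norm (?S s u)
            \<le> sqrt ?\<epsilon> / 2 * exp (- (2 * ?\<epsilon>) * s) + 1 / (2 * sqrt ?\<epsilon>) * (norm (?S s u))\<^sup>2"
          using young[of "sqrt ?\<epsilon>" "exp (- ?\<epsilon> * s)" "norm (?S s u)"] pos by simp
      qed simp
      finally show "norm (((\<lambda>v. cinner v u) \<circ> (\<lambda>s. E s y)) s)
          \<le> norm y * (sqrt ?\<epsilon> / 2 * exp (- (2 * ?\<epsilon>) * s) + 1 / (2 * sqrt ?\<epsilon>) * (norm (?S s u))\<^sup>2)"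
        by simp
    qed
    also have "\<dots> = norm y * (sqrt ?\<epsilon> / 2 * integral {0..t} (\<lambda>s. exp (- (2 * ?\<epsilon>) * s))
        + 1 / (2 * sqrt ?\<epsilon>) * integral {0..t} (\<lambda>s. (norm (?S s u))\<^sup>2))"
    proof -
      have 1: "(\<lambda>s. sqrt ?\<epsilon> / 2 * exp (- (2 * ?\<epsilon>) * s)) integrable_on {0..t}"
        by (intro integrable_continuous_real continuous_intros)
      have 2: "(\<lambda>s. 1 / (2 * sqrt ?\<epsilon>) * (norm (?S s u))\<^sup>2) integrable_on {0..t}"
        by (intro integrable_continuous_real continuous_intros continuous_on_subset[OF contS]) auto
      show ?thesis
        by (simp only: integral_mult_right Henstock_Kurzweil_Integration.integral_add[OF 1 2])
    qed
    also have "\<dots> \<le> norm y * (sqrt ?\<epsilon> / 2 * (1 / (2 * ?\<epsilon>)) + 1 / (2 * sqrt ?\<epsilon>) * K)"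
      using integral_exp_le[of "2 * ?\<epsilon>" 0 t] K[OF t] pos t
      by (intro mult_left_mono add_mono) auto
    also have "sqrt ?\<epsilon> / 2 * (1 / (2 * ?\<epsilon>)) + 1 / (2 * sqrt ?\<epsilon>) * K = (1 / 4 + K / 2) / sqrt ?\<epsilon>"
    proof -
      have "r / 2 * (1 / (2 * r\<^sup>2)) + 1 / (2 * r) * K = (1 / 4 + K / 2) / r" if "r > 0" for r
        using that by (simp add: power2_eq_square field_simps)
      from this[of "sqrt ?\<epsilon>"] show ?thesis
        using pos by (simp only: real_sqrt_gt_0_iff real_sqrt_pow2 less_imp_le)
    qed
    finally show ?thesis by (simp add: mult.commute)
  qed
  have "((\<lambda>t. E t x) \<longlongrightarrow> 0) at_top"
  proof (rule Lim_null_comparison)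
    have "filterlim (\<lambda>t. (\<delta> - ?\<epsilon>) * t) at_bot at_top"
      using \<delta> by (intro filterlim_tendsto_neg_mult_at_bot[OF tendsto_const] filterlim_ident) auto
    from tendsto_mult_left[OF filterlim_compose[OF exp_at_bot this], of "M * norm x"]
    show "((\<lambda>t. M * norm x * exp ((\<delta> - ?\<epsilon>) * t)) \<longlongrightarrow> 0) at_top" by simp
    show "\<forall>\<^sub>F t in at_top. norm (E t x) \<le> M * norm x * exp ((\<delta> - ?\<epsilon>) * t)"
      using eventually_ge_at_top[of 0]
    proof eventually_elim
      case (elim t)
      have "norm (E t x) \<le> exp (- ?\<epsilon> * t) * (M * exp (\<delta> * t) * norm x)"
        unfolding normE using elim by (intro mult_left_mono growth) auto
      also have "\<dots> = M * norm x * (exp (\<delta> * t) * exp (- ?\<epsilon> * t))"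
        by (simp add: mult_ac)
      also have "exp (\<delta> * t) * exp (- ?\<epsilon> * t) = exp ((\<delta> - ?\<epsilon>) * t)"
        by (simp add: algebra_simps flip: exp_add)
      finally show ?case .
    qed
  qed
  then have "((\<lambda>t. cmod (cinner (E t x - x) u)) \<longlongrightarrow> cmod (cinner (0 - x) u)) at_top"
    by (intro tendsto_norm tendsto_cinner tendsto_diff tendsto_const)
  then have "cmod (cinner (0 - x) u) \<le> (1 / 4 + K / 2) / sqrt ?\<epsilon> * norm y"
    by (rule tendsto_upperbound[OF _ eventually_mono[OF eventually_ge_at_top[of 0] bound]
          trivial_limit_at_top_linorder])
  then show ?thesis by (simp add: cinner_minus_left)
qed

text \<open>
  If \<open>R\<close> is the resolvent at \<open>\<mu> + \<epsilon>\<close>, then \<open>(A - \<mu>) x = w\<close> is the fixed point equation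
  \<open>x = R (w - \<epsilon> x)\<close>, a contraction with factor \<open>1/2\<close>.
\<close>

lemma resolvent_set_perturb:
  assumes R: "bounded_clinear R" "\<And>x w. (x, w) \<in> scalar_plus (- (\<mu> + of_real \<epsilon>)) A \<longleftrightarrow> x = R w"
    and \<epsilon>: "\<epsilon> > 0" and le: "\<And>y. norm (R y) \<le> 1 / (2 * \<epsilon>) * norm y"
  shows "\<mu> \<in> resolvent_set A"
proof -
  interpret R: bounded_linear R using R(1) by (simp add: bounded_clinear_def)
  have RC: "R (a *\<^sub>C x) = a *\<^sub>C R x" for a x using R(1) by (simp add: bounded_clinear_def)
  have "\<exists>!x. R (w - \<epsilon> *\<^sub>R x) = x" for w
  proof (rule banach_fix_type[where c = "1/2"])
    show "\<forall>x y. dist (R (w - \<epsilon> *\<^sub>R x)) (R (w - \<epsilon> *\<^sub>R y)) \<le> 1 / 2 * dist x y"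
    proof (intro allI)
      fix x y
      have "dist (R (w - \<epsilon> *\<^sub>R x)) (R (w - \<epsilon> *\<^sub>R y)) = norm (R (\<epsilon> *\<^sub>R (y - x)))"
        by (simp add: dist_norm R.diff [symmetric] scaleR_diff_right)
      also have "\<dots> \<le> 1 / (2 * \<epsilon>) * norm (\<epsilon> *\<^sub>R (y - x))" by (rule le)
      also have "\<dots> = 1 / 2 * dist x y"
        using \<epsilon> by (simp add: dist_norm norm_minus_commute)
      finally show "dist (R (w - \<epsilon> *\<^sub>R x)) (R (w - \<epsilon> *\<^sub>R y)) \<le> 1 / 2 * dist x y" .
    qed
  qed auto
  then obtain R' where R': "\<And>w x. R (w - \<epsilon> *\<^sub>R x) = x \<longleftrightarrow> x = R' w" by metis
  have fix_R': "R (w - \<epsilon> *\<^sub>R R' w) = R' w" for w using R' by blast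
  have C: "R' (a *\<^sub>C x) = a *\<^sub>C R' x" for a x
  proof (rule R'[THEN iffD1, symmetric])
    show "R (a *\<^sub>C x - \<epsilon> *\<^sub>R a *\<^sub>C R' x) = a *\<^sub>C R' x"
      by (metis RC fix_R' scaleC_diff_right scaleC_scaleR)
  qed
  have "bounded_linear R'"
  proof (rule bounded_linear_intro)
    show "R' (x + y) = R' x + R' y" for x y
    proof (rule R'[THEN iffD1, symmetric])
      have "x + y - \<epsilon> *\<^sub>R (R' x + R' y) = (x - \<epsilon> *\<^sub>R R' x) + (y - \<epsilon> *\<^sub>R R' y)"
        by (simp add: scaleR_add_right)
      then show "R (x + y - \<epsilon> *\<^sub>R (R' x + R' y)) = R' x + R' y"
        by (simp only: R.add fix_R')
    qed
    show "R' (r *\<^sub>R x) = r *\<^sub>R R' x" for r x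
      by (metis C scaleC_of_real)
    show "norm (R' x) \<le> norm x * (1 / \<epsilon>)" for x
    proof -
      have "norm (R' x) \<le> 1 / (2 * \<epsilon>) * norm (x - \<epsilon> *\<^sub>R R' x)"
        using le[of "x - \<epsilon> *\<^sub>R R' x"] by (simp only: fix_R')
      also have "\<dots> \<le> 1 / (2 * \<epsilon>) * (norm x + \<epsilon> * norm (R' x))"
        using \<epsilon> norm_triangle_ineq4[of x "\<epsilon> *\<^sub>R R' x"] by (intro mult_left_mono) auto
      also have "\<dots> = norm x * (1 / \<epsilon>) / 2 + norm (R' x) / 2"
        using \<epsilon> by (simp add: field_simps)
      finally show ?thesis by simp
    qed
  qed
  with C have "bounded_clinear R'" by (simp add: bounded_clinear_def)
  moreover have "(x, w) \<in> scalar_plus (- \<mu>) A \<longleftrightarrow> x = R' w" for x w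
  proof -
    have "w - (- \<mu>) *\<^sub>C x = (w - \<epsilon> *\<^sub>R x) - (- (\<mu> + of_real \<epsilon>)) *\<^sub>C x"
      by (simp only: scaleC_minus_left) (simp add: scaleC_add_left scaleC_of_real)
    then have "(x, w) \<in> scalar_plus (- \<mu>) A \<longleftrightarrow> (x, w - \<epsilon> *\<^sub>R x) \<in> scalar_plus (- (\<mu> + of_real \<epsilon>)) A"
      by (simp only: mem_scalar_plus_iff)
    also have "\<dots> \<longleftrightarrow> x = R' w"
      unfolding R(2) using R'[of w x] by auto
    finally show ?thesis .
  qed
  ultimately show ?thesis by (rule resolvent_setI)
qed

text \<open>
  If all orbits of the adjoint semigroup were square integrable, the resolvent at \<open>\<mu> + \<epsilon>\<close> would be
  \<open>O(1 / \<surd>\<epsilon>)\<close>, by the weak bounds and the uniform boundedness principle. But near a point of the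
  spectrum it grows at least like \<open>1 / \<epsilon>\<close>.
\<close>

lemma orbit_not_square_integrable:
  assumes gen: "generates A T"
    and growth: "\<And>\<delta>. \<delta> > 0 \<Longrightarrow> \<exists>M. \<forall>t\<ge>0. \<forall>x. norm (T t x) \<le> M * exp (\<delta> * t) * norm x"
    and spec: "\<mu> \<in> spec A" "Re \<mu> = 0"
    and right: "\<And>z. Re z > 0 \<Longrightarrow> z \<in> resolvent_set A"
  obtains u where "\<And>K. \<exists>t\<ge>0. K < integral {0..t} (\<lambda>s. (norm (adj (T s) u))\<^sup>2)"
proof (rule ccontr)
  assume "\<not> thesis"
  then have "\<exists>K. \<forall>t\<ge>0. integral {0..t} (\<lambda>s. (norm (adj (T s) u))\<^sup>2) \<le> K" for u
    using that by (metis not_le)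
  then obtain K where K: "\<And>u t. 0 \<le> t \<Longrightarrow> integral {0..t} (\<lambda>s. (norm (adj (T s) u))\<^sup>2) \<le> K u"
    by metis
  have "\<exists>R. bounded_clinear R \<and>
      (\<forall>x w. (x, w) \<in> scalar_plus (- (\<mu> + of_real \<epsilon>)) A \<longleftrightarrow> x = R w)" if "\<epsilon> > 0" for \<epsilon>
    by (rule resolvent_setE[OF right[of "\<mu> + of_real \<epsilon>"]]) (use spec that in auto)
  then obtain R where R: "\<And>\<epsilon>. \<epsilon> > 0 \<Longrightarrow> bounded_clinear (R \<epsilon>)"
    "\<And>\<epsilon> x w. \<epsilon> > 0 \<Longrightarrow> (x, w) \<in> scalar_plus (- (\<mu> + of_real \<epsilon>)) A \<longleftrightarrow> x = R \<epsilon> w"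
    by metis
  have weak: "cmod (cinner (R \<epsilon> y) u) \<le> (1 / 4 + K u / 2) / sqrt \<epsilon> * norm y" if \<epsilon>: "\<epsilon> > 0" for \<epsilon> y u
  proof -
    obtain M where "\<And>t x. 0 \<le> t \<Longrightarrow> norm (T t x) \<le> M * exp (\<epsilon> / 2 * t) * norm x"
      using growth[of "\<epsilon> / 2"] \<epsilon> by auto
    then show ?thesis
      using resolvent_weak_bound[OF gen right[of 1], of M "\<epsilon> / 2" "\<mu> + of_real \<epsilon>" u "K u" "R \<epsilon> y" y]
        \<epsilon> spec K R(2)[OF \<epsilon>] by simp
  qed
  obtain C where C: "C \<ge> 0" "\<And>x. x \<in> {sqrt \<epsilon> *\<^sub>R R \<epsilon> y | \<epsilon> y. \<epsilon> > 0 \<and> norm y \<le> 1} \<Longrightarrow> norm x \<le> C"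
  proof (rule weakly_bounded_imp_bounded)
    fix u
    have "cmod (cinner (sqrt \<epsilon> *\<^sub>R R \<epsilon> y) u) \<le> 1 / 4 + K u / 2" if "\<epsilon> > 0" "norm y \<le> 1" for \<epsilon> y
    proof -
      have "K u \<ge> 0" using K[of 0 u] by simp
      have "cmod (cinner (sqrt \<epsilon> *\<^sub>R R \<epsilon> y) u) = sqrt \<epsilon> * cmod (cinner (R \<epsilon> y) u)"
        using that by (simp add: cinner_scaleR_left norm_mult)
      also have "\<dots> \<le> sqrt \<epsilon> * ((1 / 4 + K u / 2) / sqrt \<epsilon> * norm y)"
        using that by (intro mult_left_mono weak) auto
      also have "\<dots> = (1 / 4 + K u / 2) * norm y"
        using that by simp
      also have "\<dots> \<le> 1 / 4 + K u / 2"
        using that \<open>K u \<ge> 0\<close> by (simp add: mult_left_le)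
      finally show ?thesis .
    qed
    then show "\<exists>K. \<forall>x\<in>{sqrt \<epsilon> *\<^sub>R R \<epsilon> y | \<epsilon> y. \<epsilon> > 0 \<and> norm y \<le> 1}. cmod (cinner x u) \<le> K"
      by blast
  qed blast
  \<comment> \<open>Small enough for \<open>C / \<surd>\<epsilon> \<le> 1 / (2 \<epsilon>)\<close>; adding \<open>1\<close> to \<open>C\<close> avoids a division by \<open>0\<close>.\<close>
  define \<epsilon> where "\<epsilon> = (1 / (2 * (C + 1)))\<^sup>2"
  have \<epsilon>: "\<epsilon> > 0" and sqrt: "sqrt \<epsilon> = 1 / (2 * (C + 1))"
    using C by (simp_all add: \<epsilon>_def)
  have "norm (R \<epsilon> y) \<le> 1 / (2 * \<epsilon>) * norm y" for y
  proof (cases "y = 0")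
    case True
    then show ?thesis using R(1)[OF \<epsilon>] by (simp add: bounded_clinear_def linear_simps)
  next
    case False
    interpret bounded_linear "R \<epsilon>" using R(1)[OF \<epsilon>] by (simp add: bounded_clinear_def)
    have "norm (sqrt \<epsilon> *\<^sub>R R \<epsilon> ((1 / norm y) *\<^sub>R y)) \<le> C"
    proof (intro C(2) CollectI exI conjI)
      show "norm ((1 / norm y) *\<^sub>R y) \<le> 1" using False by simp
    qed (use \<epsilon> in simp_all)
    then have "sqrt \<epsilon> * norm (R \<epsilon> y) \<le> C * norm y"
      using False \<epsilon> by (simp add: scaleR field_simps)
    also have "\<dots> \<le> (C + 1) * norm y" by (intro mult_right_mono) auto
    finally have "norm (R \<epsilon> y) \<le> (2 * (C + 1)) * ((C + 1) * norm y)"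
      using C by (simp add: sqrt field_simps)
    also have "\<dots> = 1 / (2 * \<epsilon>) * norm y"
      using C by (simp add: \<epsilon>_def power2_eq_square)
    finally show ?thesis .
  qed
  then have "\<mu> \<in> resolvent_set A"
    using R \<epsilon> by (intro resolvent_set_perturb[of "R \<epsilon>" \<mu> \<epsilon>]) auto
  then show False using spec by (simp add: spec_def)
qed

section \<open>Divergence of the covariance\<close>

lemma zero_stable_bound:
  assumes gen: "generates A T" and stable: "zero_stable A"
  obtains M where "\<And>t x. 0 \<le> t \<Longrightarrow> norm (T t x) \<le> M * norm x"
proof -
  have T: "C0_semigroup T" using gen by (simp add: generates_def)
  obtain \<delta> where \<delta>: "\<delta> > 0" "\<And>u t. norm u < \<delta> \<Longrightarrow> 0 \<le> t \<Longrightarrow> norm (T t u) < 1"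
    using stable sg_exp_eq[OF gen] unfolding zero_stable_def by (metis zero_less_one)
  have "norm (T t x) \<le> 2 / \<delta> * norm x" if t: "0 \<le> t" for t x
  proof -
    interpret bounded_linear "T t" by (rule C0_semigroup_bounded_linear[OF T t])
    show ?thesis
    proof (cases "x = 0")
      case False
      have "norm (T t ((\<delta> / (2 * norm x)) *\<^sub>R x)) < 1"
        using \<delta>(1) False t by (intro \<delta>(2)) auto
      then show ?thesis using False \<delta>(1) by (simp add: scaleR field_simps)
    qed (simp add: zero)
  qed
  then show ?thesis by (rule that)
qed

theorem theorem4p7:
  fixes \<A> B Q :: "'a::complex_hilbert operator"
    and \<sigma> c :: real and lambda_star :: complex and spec_minus :: "complex set"
  assumes "closed_operator \<A>"
    and "\<And>p::real. \<exists>T. generates (scalar_plus (complex_of_real p) \<A>) T"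
    and "\<And>p::real. p < 0 \<Longrightarrow> zero_stable (scalar_plus (complex_of_real p) \<A>)"
    and "self_adjoint Q" and "nonnegative Q"
    and "linear_operator B" and "densely_defined B"
    and "\<sigma> > 0"
    and "spec \<A> = {lambda_star} \<union> spec_minus"
    and "Re lambda_star = 0" and "spec_minus \<subseteq> {z. Re z < 0}"
    and "c > 0" and "bounded_below_by (noise_cov B Q) c"
  shows "\<exists>u :: nat \<Rightarrow> 'a. \<forall>k.
    filterlim
      (\<lambda>p::real. Re (cinner (cov_inf \<sigma> (scalar_plus (complex_of_real p) \<A>) B Q (u k)) (u k)))
      at_top (at_left 0)"
proof -
  let ?A = "\<lambda>p. scalar_plus (complex_of_real p) \<A>"
  let ?N = "op_apply (noise_cov B Q)"
  have N: "bounded_linear ?N" "\<And>h. c * (norm h)\<^sup>2 \<le> Re (cinner (?N h) h)"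
    using noise_cov_bounded assms by blast+
  have "?A 0 = \<A>" by (auto simp: mem_scalar_plus_iff)
  then obtain T where gen: "generates \<A> T" using assms(2)[of 0] by auto
  have T: "C0_semigroup T" using gen by (simp add: generates_def)
  have right: "z \<in> resolvent_set \<A>" if "Re z > 0" for z
  proof (rule ccontr)
    assume "z \<notin> resolvent_set \<A>"
    then have "z \<in> spec \<A>" by (simp add: spec_def)
    then have "z \<in> {lambda_star} \<union> spec_minus" unfolding assms(9) .
    then show False using assms(10,11) that by auto
  qed
  have gen_p: "generates (?A p) (\<lambda>t x. exp (of_real t * of_real p) *\<^sub>C T t x)" for p
    by (rule generates_rescale[OF gen])
  have growth: "\<exists>M. \<forall>t\<ge>0. \<forall>x. norm (T t x) \<le> M * exp (\<delta> * t) * norm x" if \<delta>: "\<delta> > 0" for \<delta>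
  proof -
    obtain M where M: "\<And>t x. 0 \<le> t \<Longrightarrow> norm (exp (of_real t * of_real (- \<delta>)) *\<^sub>C T t x) \<le> M * norm x"
      using zero_stable_bound[OF gen_p assms(3)[of "- \<delta>"]] \<delta> by auto
    have "norm (T t x) \<le> M * exp (\<delta> * t) * norm x" if "0 \<le> t" for t x
    proof -
      have "exp (- (\<delta> * t)) * norm (T t x) \<le> M * norm x"
        using M[OF that, of x] by (simp add: norm_scaleC norm_exp_eq_Re mult.commute)
      then show ?thesis by (simp add: exp_minus field_simps)
    qed
    then show ?thesis by blast
  qed
  obtain u where u: "\<And>K. \<exists>t\<ge>0. K < integral {0..t} (\<lambda>s. (norm (adj (T s) u))\<^sup>2)"
    by (rule orbit_not_square_integrable[OF gen growth _ _ right, of lambda_star])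
      (use assms(9,10) in auto)
  have contS: "continuous_on {0..} (\<lambda>s. adj (T s) u)"
  proof -
    have "C0_semigroup (\<lambda>t. adj (T t))"
      using generates_adj[OF gen right[of 1]] by (simp add: generates_def)
    from C0_semigroup_continuous_on[OF this continuous_on_const] show ?thesis by simp
  qed
  have lower: "\<sigma>\<^sup>2 * (c * (exp (2 * p * t) * integral {0..t} (\<lambda>s. (norm (adj (T s) u))\<^sup>2)))
      \<le> Re (cinner (cov_inf \<sigma> (?A p) B Q u) u)" if p: "p < 0" and t: "0 \<le> t" for p t
  proof -
    let ?T = "\<lambda>t x. exp (of_real t * of_real p) *\<^sub>C T t x"
    \<comment> \<open>Half of the decay of \<open>e\<^sup>p\<^sup>t\<close> compensates the possible growth of \<open>T\<close>, the other half remains.\<close>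
    obtain M where M: "\<And>t x. 0 \<le> t \<Longrightarrow> norm (T t x) \<le> M * exp (- p / 2 * t) * norm x"
      using growth[of "- p / 2"] p by auto
    have stable: "norm (?T t x) \<le> M * exp (- (- p / 2) * t) * norm x" if "0 \<le> t" for t x
    proof -
      have "norm (?T t x) \<le> exp (p * t) * (M * exp (- p / 2 * t) * norm x)"
        using M[OF that, of x] by (simp add: norm_scaleC norm_exp_eq_Re mult.commute mult_left_mono)
      also have "\<dots> = M * (exp (p * t) * exp (- p / 2 * t)) * norm x" by (simp add: mult_ac)
      also have "exp (p * t) * exp (- p / 2 * t) = exp (- (- p / 2) * t)"
        by (simp add: field_simps flip: exp_add)
      finally show ?thesis .
    qed
    have adj: "adj (?T s) u = exp (p * s) *\<^sub>R adj (T s) u" if "0 \<le> s" for s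
    proof (rule cinner_eqI)
      fix x
      have "bounded_clinear (?T s)"
        using gen_p that by (intro C0_semigroup_bounded_clinear) (auto simp: generates_def)
      from cinner_adj[OF this, of x u] show "cinner x (adj (?T s) u) = cinner x (exp (p * s) *\<^sub>R adj (T s) u)"
        by (simp add: cinner_scaleC_left cinner_scaleR_right exp_of_real [symmetric] mult.commute
            cinner_adj[OF C0_semigroup_bounded_clinear[OF T that]])
    qed
    have "exp (2 * p * t) * integral {0..t} (\<lambda>s. (norm (adj (T s) u))\<^sup>2)
        = integral {0..t} (\<lambda>s. exp (2 * p * t) * (norm (adj (T s) u))\<^sup>2)"
      by simp
    also have "\<dots> \<le> integral {0..t} (\<lambda>s. (norm (exp (p * s) *\<^sub>R adj (T s) u))\<^sup>2)"
    proof (rule integral_le)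
      show "(\<lambda>s. exp (2 * p * t) * (norm (adj (T s) u))\<^sup>2) integrable_on {0..t}"
        by (intro integrable_continuous_real continuous_intros continuous_on_subset[OF contS]) auto
      show "(\<lambda>s. (norm (exp (p * s) *\<^sub>R adj (T s) u))\<^sup>2) integrable_on {0..t}"
        by (intro integrable_continuous_real continuous_intros continuous_on_subset[OF contS]) auto
      fix s assume s: "s \<in> {0..t}"
      then have "exp (2 * p * t) \<le> (exp (p * s))\<^sup>2"
        using p by (simp add: power2_eq_square flip: exp_add)
      then show "exp (2 * p * t) * (norm (adj (T s) u))\<^sup>2 \<le> (norm (exp (p * s) *\<^sub>R adj (T s) u))\<^sup>2"
        by (simp add: power_mult_distrib mult_right_mono)
    qed
    also have "\<dots> = integral {0..t} (\<lambda>s. (norm (adj (?T s) u))\<^sup>2)"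
      by (intro integral_cong) (simp add: adj)
    finally have "\<sigma>\<^sup>2 * (c * (exp (2 * p * t) * integral {0..t} (\<lambda>s. (norm (adj (T s) u))\<^sup>2)))
        \<le> \<sigma>\<^sup>2 * (c * integral {0..t} (\<lambda>s. (norm (adj (?T s) u))\<^sup>2))"
      using assms(12) by (intro mult_left_mono) auto
    also have "\<dots> \<le> Re (cinner (cov_inf \<sigma> (?A p) B Q u) u)"
    proof (rule cov_inf_lower_bound[OF gen_p _ _ stable N(1) _ N(2) t])
      show "of_real p + 1 \<in> resolvent_set (?A p)"
        using right[of 1] by (simp add: resolvent_set_scalar_plus)
    qed (use p assms(12) in auto)
    finally show ?thesis .
  qed
  have "filterlim (\<lambda>p. Re (cinner (cov_inf \<sigma> (?A p) B Q u) u)) at_top (at_left 0)"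
    unfolding filterlim_at_top
  proof
    fix Z :: real
    have \<sigma>c: "\<sigma>\<^sup>2 * c > 0" using assms(8,12) by simp
    \<comment> \<open>The factor \<open>2\<close> makes up for the weight \<open>e\<^sup>2\<^sup>p\<^sup>t\<close>, which exceeds \<open>1/2\<close> for \<open>p\<close> near \<open>0\<close>.\<close>
    obtain t where t: "t \<ge> 0" "2 * \<bar>Z\<bar> / (\<sigma>\<^sup>2 * c) < integral {0..t} (\<lambda>s. (norm (adj (T s) u))\<^sup>2)"
      using u by blast
    let ?J = "integral {0..t} (\<lambda>s. (norm (adj (T s) u))\<^sup>2)"
    have J: "\<bar>Z\<bar> \<le> \<sigma>\<^sup>2 * c * (1 / 2 * ?J)" "?J \<ge> 0"
      using t(2) \<sigma>c by (simp add: field_simps, intro integral_nonneg integrable_continuous_real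
          continuous_intros continuous_on_subset[OF contS]) auto
    have "((\<lambda>p. exp (2 * p * t)) \<longlongrightarrow> exp (2 * 0 * t)) (at_left 0)"
      by (intro tendsto_intros)
    then have "\<forall>\<^sub>F p in at_left 0. exp (2 * p * t) > 1 / 2"
      by (rule order_tendstoD(1)) simp
    moreover have "\<forall>\<^sub>F p in at_left 0. p < (0::real)"
      by (simp add: eventually_at_filter)
    ultimately show "\<forall>\<^sub>F p in at_left 0. Z \<le> Re (cinner (cov_inf \<sigma> (?A p) B Q u) u)"
    proof eventually_elim
      case (elim p)
      have "Z \<le> \<sigma>\<^sup>2 * c * (1 / 2 * ?J)" using J by linarith
      also have "\<dots> \<le> \<sigma>\<^sup>2 * c * (exp (2 * p * t) * ?J)"
        using elim \<sigma>c J by (intro mult_left_mono mult_right_mono) auto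
      also have "\<dots> \<le> Re (cinner (cov_inf \<sigma> (?A p) B Q u) u)"
        using lower[OF elim(2) t(1)] by (simp add: mult.assoc)
      finally show ?case .
    qed
  qed
  then show ?thesis by (intro exI[of _ "\<lambda>_. u"]) simp
qed

end
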